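(* For every integer $n \ge 1$, $gp(ST_3^n) = 3$ if $n = 1$ and $gp(ST_3^n) = 3^{n-1} + 3$ if $n \ge 2$. Moreover, if $n \ge 2$, then a set $M \subseteq V(ST_3^n)$ is a general position set of $ST_3^n$ of cardinality $gp(ST_3^n)$ if and only if $M = \left(\bigcup_{H \in \mathcal{H}_2^n} P_H\right) \cup X(ST_3^n)$.
   Context: Sierpiński triangle graphs are defined recursively: $ST_3^0 = K_3$, whose three vertices are its extreme vertices, called top, left and right. For $n \ge 0$, $ST_3^{n+1}$ is obtained from three disjoint copies $T, L, R$ of $ST_3^n$ by identifying the left extreme vertex of $T$ with the top extreme vertex of $L$, the right extreme vertex of $T$ with the top extreme vertex of $R$, and the right extreme vertex of $L$ with the left extreme vertex of $R$; the extreme vertices of $ST_3^{n+1}$ are the top vertex of $T$, the left vertex of $L$ and the right vertex of $R$. $X(G)$ denotes the set of extreme vertices. For $0 \le m \le n$, the copies of $ST_3^m$ in $ST_3^n$ are: for $m=n$ the graph itself, and for $m<n$ the copies of $ST_3^m$ in each of the three copies $T,L,R$ of $ST_3^{n-1}$ used in the construction (recursively); each copy has its own extreme vertices. $\mathcal{H}_2^n$ denotes the set of all $3^{n-2}$ copies of $ST_3^2$ in $ST_3^n$. The interval $I(u,v)$ is the set of vertices lying on shortest $u,v$-paths. For a copy $H$ of $ST_3^2$ with extreme vertices $p_0,p_1,p_2$, its proper vertices are the vertices of $H$ not in $I(p_0,p_1)\cup I(p_0,p_2)\cup I(p_1,p_2)$; there are exactly three, and their set is $P_H$. A set $M \subseteq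 V(G)$ is a general position set if there are no three distinct vertices $u,v,w \in M$ with $d(u,v) = d(u,w) + d(w,v)$, where $d$ is the shortest-path distance; $gp(G)$ is the largest cardinality of a general position set of $G$. *)

theory Defs
  imports "Graph_Theory.Pair_Digraph" "Graph_Theory.Shortest_Path"
begin

text \<open>
  Undirected simple graphs are represented by \<^typ>\<open>'a pair_pre_digraph\<close> with a symmetric,
  irreflexive set of arcs (see \<open>pair_graph_ST\<close> below for the graphs considered here).
\<close>

section \<open>Distance, intervals and general position\<close>

text \<open>Shortest-path distance: every arc has weight 1.\<close>

definition gdist :: "'a pair_pre_digraph \<Rightarrow> 'a \<Rightarrow> 'a \<Rightarrow> ereal" where
  "gdist G u v = wf_digraph.\<mu> (with_proj G) (\<lambda>_. 1) u v"

definition interval :: "'a pair_pre_digraph \<Rightarrow> 'a \<Rightarrow> 'a \<Rightarrow> 'a set" where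
  "interval G u v =
     {w. \<exists>p. pre_digraph.apath (with_proj G) u p v \<and> ereal (real (length p)) = gdist G u v
           \<and> w \<in> set (pre_digraph.awalk_verts (with_proj G) u p)}"

definition general_position :: "'a pair_pre_digraph \<Rightarrow> 'a set \<Rightarrow> bool" where
  "general_position G M \<longleftrightarrow> M \<subseteq> pverts G \<and>
     \<not> (\<exists>u\<in>M. \<exists>v\<in>M. \<exists>w\<in>M. u \<noteq> v \<and> u \<noteq> w \<and> v \<noteq> w \<and>
          gdist G u v = gdist G u w + gdist G w v)"

definition gp :: "'a pair_pre_digraph \<Rightarrow> nat" where
  "gp G = Max {card M | M. general_position G M}"


section \<open>Sierpinski triangle graphs\<close>

datatype corner = Top | Left | Right

text \<open>
  The vertex type does not depend on the recursion depth. In a graph of depth \<open>Suc n\<close>,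
  \<open>Corner c\<close> is the extreme vertex in direction \<open>c\<close>, \<open>Mid {c, d}\<close> is the vertex obtained by
  identifying extreme vertex \<open>d\<close> of copy \<open>c\<close> with extreme vertex \<open>c\<close> of copy \<open>d\<close>, and
  \<open>In c v\<close> is the non-extreme vertex \<open>v\<close> of copy \<open>c\<close>. The copies \<open>T\<close>, \<open>L\<close>, \<open>R\<close> of the
  construction are those with \<open>c = Top\<close>, \<open>Left\<close>, \<open>Right\<close>, and \<open>inj_copy c\<close> maps a vertex of a
  graph of depth \<open>n\<close> to the corresponding vertex of copy \<open>c\<close> in the graph of depth \<open>Suc n\<close>.
\<close>

datatype vertex = Corner corner | Mid "corner set" | In corner vertex

fun inj_copy :: "corner \<Rightarrow> vertex \<Rightarrow> vertex" where
  "inj_copy c (Corner d) = (if c = d then Corner c else Mid {c, d})"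
| "inj_copy c (Mid S) = In c (Mid S)"
| "inj_copy c (In d v) = In c (In d v)"

text \<open>
  The three tagged copies are glued along exactly the prescribed identifications: left vertex of
  \<open>T\<close> with top vertex of \<open>L\<close>, right vertex of \<open>T\<close> with top vertex of \<open>R\<close>, and right vertex of
  \<open>L\<close> with left vertex of \<open>R\<close>.
\<close>

lemma inj_copy_eq_iff:
  "inj_copy c v = inj_copy d w \<longleftrightarrow>
     c = d \<and> v = w \<or> c \<noteq> d \<and> v = Corner d \<and> w = Corner c"
  by (cases v; cases w) (auto simp: doubleton_eq_iff)

record triangle_graph =
  graph_of :: "vertex pair_pre_digraph"
  extreme :: "corner \<Rightarrow> vertex"

definition copy_of :: "corner \<Rightarrow> triangle_graph \<Rightarrow> triangle_graph" where
  "copy_of c H =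
     \<lparr>graph_of = \<lparr>pverts = inj_copy c ` pverts (graph_of H),
               parcs = map_prod (inj_copy c) (inj_copy c) ` parcs (graph_of H)\<rparr>,
      extreme = inj_copy c \<circ> extreme H\<rparr>"

primrec ST :: "nat \<Rightarrow> triangle_graph" where
  "ST 0 =
     \<lparr>graph_of = \<lparr>pverts = range Corner, parcs = {(Corner c, Corner d) | c d. c \<noteq> d}\<rparr>,
      extreme = Corner\<rparr>"
| "ST (Suc n) =
     \<lparr>graph_of = \<lparr>pverts = (\<Union>c. pverts (graph_of (copy_of c (ST n)))),
               parcs = (\<Union>c. parcs (graph_of (copy_of c (ST n))))\<rparr>,
      extreme = (\<lambda>c. extreme (copy_of c (ST n)) c)\<rparr>"

text \<open>The copies of \<open>ST m\<close> in \<open>ST n\<close>; there are none if \<open>n < m\<close>.\<close>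

primrec copies :: "nat \<Rightarrow> nat \<Rightarrow> triangle_graph set" where
  "copies m 0 = (if m = 0 then {ST 0} else {})"
| "copies m (Suc n) = (if m = Suc n then {ST (Suc n)} else (\<Union>c. copy_of c ` copies m n))"

text \<open>The intervals are taken in the ambient graph \<open>G\<close>.\<close>

definition proper_vertices :: "vertex pair_pre_digraph \<Rightarrow> triangle_graph \<Rightarrow> vertex set" where
  "proper_vertices G H = pverts (graph_of H) -
     (interval G (extreme H Top) (extreme H Left) \<union>
      interval G (extreme H Top) (extreme H Right) \<union>
      interval G (extreme H Left) (extreme H Right))"


section \<open>Basic properties of the construction\<close>

lemma extreme_ST: "extreme (ST n) = Corner"
  by (induction n) (auto simp: copy_of_def fun_eq_iff)

lemma UNIV_corner: "(UNIV :: corner set) = {Top, Left, Right}"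
  using corner.exhaust by blast

instance corner :: finite
  by standard (simp add: UNIV_corner)

lemma pair_graph_ST: "pair_graph (graph_of (ST n))"
proof -
  have fin: "finite (pverts (graph_of (ST n)))"
    by (induction n) (auto simp: copy_of_def)
  have wf: "fst e \<in> pverts (graph_of (ST n)) \<and> snd e \<in> pverts (graph_of (ST n)) \<and> fst e \<noteq> snd e"
    if "e \<in> parcs (graph_of (ST n))" for e
    using that
    by (induction n arbitrary: e) (fastforce simp: copy_of_def inj_copy_eq_iff)+
  have sym: "sym (parcs (graph_of (ST n)))"
  proof (induction n)
    case 0
    show ?case by (auto simp: sym_def)
  next
    case (Suc n)
    then show ?case by (fastforce simp: sym_def copy_of_def)
  qed
  have "parcs (graph_of (ST n)) \<subseteq> pverts (graph_of (ST n)) \<times> pverts (graph_of (ST n))"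
    using wf by fastforce
  then have "finite (parcs (graph_of (ST n)))"
    using fin finite_subset by blast
  then show ?thesis
    using fin wf sym by unfold_locales (auto simp: symmetric_def)
qed

lemma inj_extreme_copies: "H \<in> copies m n \<Longrightarrow> inj (extreme H)"
proof (induction n arbitrary: H)
  case 0
  then show ?case by (simp add: inj_def split: if_splits)
next
  case (Suc n)
  show ?case
  proof (cases "m = Suc n")
    case True
    with Suc.prems have "H = ST m" by simp
    then show ?thesis by (simp add: extreme_ST inj_def)
  next
    case False
    with Suc.prems obtain c H' where "H' \<in> copies m n" "H = copy_of c H'" by auto
    then show ?thesis
      using Suc.IH[of H'] by (simp add: copy_of_def inj_def inj_copy_eq_iff)
  qed
qed

lemma inj_copy_of: "inj (copy_of c)"
proof (rule injI)
  fix H K :: triangle_graph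
  assume eq: "copy_of c H = copy_of c K"
  have inj: "inj (inj_copy c)"
    by (simp add: inj_def inj_copy_eq_iff)
  then have "inj (map_prod (inj_copy c) (inj_copy c))"
    by (simp add: prod.inj_map)
  with inj eq show "H = K"
    by (cases H; cases K) (auto simp: copy_of_def inj_image_eq_iff fun.inj_map_strong fun_eq_iff
      inj_copy_eq_iff intro!: pair_pre_digraph.equality)
qed

lemma card_copies: "m \<le> n \<Longrightarrow> finite (copies m n) \<and> card (copies m n) = 3 ^ (n - m)"
proof (induction n)
  case 0
  then show ?case by simp
next
  case (Suc n)
  show ?case
  proof (cases "m = Suc n")
    case True
    then show ?thesis by simp
  next
    case False
    with Suc have IH: "finite (copies m n)" "card (copies m n) = 3 ^ (n - m)" and "m \<le> n"
      by auto
    have disj: "copy_of c ` copies m n \<inter> copy_of d ` copies m n = {}" if "c \<noteq> d" for c d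
    proof -
      have "copy_of c H \<noteq> copy_of d K" if "H \<in> copies m n" for H K
      proof
        assume "copy_of c H = copy_of d K"
        then have "extreme H k = Corner d" for k
          using \<open>c \<noteq> d\<close> by (auto simp: copy_of_def fun_eq_iff inj_copy_eq_iff)
        then show False
          using inj_extreme_copies[OF that] by (metis corner.distinct(1) injD)
      qed
      then show ?thesis by blast
    qed
    have "card (\<Union>c. copy_of c ` copies m n) = (\<Sum>c\<in>UNIV. card (copy_of c ` copies m n))"
      by (rule card_UN_disjoint) (use IH disj in auto)
    also have "\<dots> = (\<Sum>c\<in>(UNIV :: corner set). 3 ^ (n - m))"
      using IH by (simp add: card_image inj_on_subset[OF inj_copy_of])
    also have "\<dots> = 3 ^ (Suc n - m)"
      using \<open>m \<le> n\<close> by (simp add: UNIV_corner Suc_diff_le)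
    finally show ?thesis
      using False IH by simp
  qed
qed

end

theory Submission
  imports Defs
begin

text \<open>
  In \<open>ST (Suc n)\<close> two points of the same copy have the same distance as in \<open>ST n\<close>; between two
  different copies a shortest path passes through their common vertex or traverses the third copy.
  For the upper bound, let a general position set \<open>M\<close> be split into its parts in the three copies.
  A point of \<open>M\<close> in another copy, seen from the given copy, acts like a point attached to one of
  its corners and forbids some pairs (a guarded corner). Inductively, a set with a set
  \<open>A\<close> of guarded corners has at most \<open>3 ^ (n - 1) + 3 - card A\<close> points; if all three copies
  contain points of \<open>M\<close>, then each has its two inner corners guarded, and
  \<open>3 * (3 ^ (n - 1) + 3 - 2) = 3 ^ n + 3\<close>. The subtle point is that an outside point may also reach
  the copy through its other inner corner, so that its guard only concerns the points closer to
  the guarded corner. Such weak guards become full ones one level below, and for depth 2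
  a finite search shows that they suffice. Uniqueness at depth 2 needs guards with some slack: they
  exist because each part of an extremal set has three points, but a corner has only two neighbours.
\<close>

section \<open>Distances and intervals as hop counts\<close>

lemma sym_relpow:
  assumes "sym r"
  shows "sym (r ^^ k)"
proof (induction k)
  case (Suc k)
  with assms show ?case
    unfolding sym_def by (metis relpow_Suc_E relpow_Suc_I2)
qed (simp add: sym_def)

context pair_wf_digraph
begin

text \<open>Walks are traded for relational powers, which are easily composed and transported along
  \<open>inj_copy\<close>.\<close>

lemma awalk_length_iff_relpow:
  "(\<exists>p. awalk u p v \<and> length p = k) \<longleftrightarrow> u \<in> pverts G \<and> (u, v) \<in> parcs G ^^ k"
proof (induction k arbitrary: u)
  case 0
  show ?case by (auto simp: awalk_Nil_iff)
next
  case (Suc k)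
  have "(\<exists>p. awalk u p v \<and> length p = Suc k) \<longleftrightarrow>
      (\<exists>w. (u, w) \<in> parcs G \<and> (\<exists>p. awalk w p v \<and> length p = k))"
  proof safe
    fix p assume "awalk u p v" "length p = Suc k"
    then show "\<exists>w. (u, w) \<in> parcs G \<and> (\<exists>p. awalk w p v \<and> length p = k)"
      by (cases p) (auto simp: awalk_Cons_iff intro!: exI)
  next
    fix w p assume "(u, w) \<in> parcs G" "awalk w p v" "k = length p"
    then show "\<exists>q. awalk u q v \<and> length q = Suc (length p)"
      by (intro exI[of _ "(u, w) # p"]) (auto simp: awalk_Cons_iff)
  qed
  also have "\<dots> \<longleftrightarrow> u \<in> pverts G \<and> (\<exists>w. (u, w) \<in> parcs G \<and> (w, v) \<in> parcs G ^^ k)"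
    using Suc.IH by (auto dest: in_arcsD1 in_arcsD2)
  also have "\<dots> \<longleftrightarrow> u \<in> pverts G \<and> (u, v) \<in> parcs G ^^ Suc k"
    by (metis relpow_Suc_D2 relpow_Suc_I2)
  finally show ?case .
qed

end

text \<open>A natural-number counterpart of \<open>gdist\<close>, suited to linear arithmetic.
  \<open>LEAST\<close> is meaningful only for reachable vertices, hence the locale
  \<open>connected_pair_graph\<close>.\<close>

definition hops :: "'a pair_pre_digraph \<Rightarrow> 'a \<Rightarrow> 'a \<Rightarrow> nat" where
  "hops G u v = (LEAST k. (u, v) \<in> parcs G ^^ k)"

lemma hops_le: "(u, v) \<in> parcs G ^^ k \<Longrightarrow> hops G u v \<le> k"
  unfolding hops_def by (rule Least_le)

locale connected_pair_graph = pair_graph +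
  assumes reach: "\<lbrakk>u \<in> pverts G; v \<in> pverts G\<rbrakk> \<Longrightarrow> \<exists>k. (u, v) \<in> parcs G ^^ k"
begin

lemma relpow_hops:
  "\<lbrakk>u \<in> pverts G; v \<in> pverts G\<rbrakk> \<Longrightarrow> (u, v) \<in> parcs G ^^ hops G u v"
  unfolding hops_def using reach by (auto intro: LeastI_ex)

lemma hops_awalk_le: "awalk u p v \<Longrightarrow> hops G u v \<le> length p"
  using awalk_length_iff_relpow[of u v "length p"] by (auto intro: hops_le)

lemma hops_awalk_ex:
  assumes "u \<in> pverts G" "v \<in> pverts G"
  obtains p where "awalk u p v" "length p = hops G u v"
  using awalk_length_iff_relpow[of u v "hops G u v"] relpow_hops assms by blast

lemma awalk_cost_one: "awalk_cost (\<lambda>_. 1) p = real (length p)"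
  by (induction p) (auto simp: awalk_cost_def)

lemma gdist_eq_hops:
  assumes "u \<in> pverts G" "v \<in> pverts G"
  shows "gdist G u v = ereal (real (hops G u v))"
proof -
  obtain p where "awalk u p v" "length p = hops G u v"
    using hops_awalk_ex assms by blast
  then show ?thesis
    unfolding gdist_def \<mu>_def
    by (intro antisym INF_lower2[of p] INF_greatest) (auto simp: awalk_cost_one hops_awalk_le)
qed

lemma hops_self [simp]: "hops G u u = 0"
  by (rule le_0_eq[THEN iffD1], rule hops_le) simp

lemma hops_eq_0_iff:
  "\<lbrakk>u \<in> pverts G; v \<in> pverts G\<rbrakk> \<Longrightarrow> hops G u v = 0 \<longleftrightarrow> u = v"
  using relpow_hops[of u v] by auto

lemma hops_commute: "hops G u v = hops G v u"
proof -
  have "sym (parcs G ^^ k)" for k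
    using pair_sym_arcs by (simp add: symmetric_def sym_relpow)
  then show ?thesis
    unfolding hops_def by (meson symD)
qed

lemma hops_triangle:
  assumes "u \<in> pverts G" "v \<in> pverts G" "w \<in> pverts G"
  shows "hops G u w \<le> hops G u v + hops G v w"
  using relpow_hops[of u v] relpow_hops[of v w] assms
  by (intro hops_le) (auto simp: relpow_add)

text \<open>Splitting a shortest path at \<open>w\<close> gives two walks, and the triangle
  inequality forces both to be shortest. Conversely, shortest walks to and from \<open>w\<close>
  concatenate to a shortest walk, which is a path.\<close>

lemma interval_eq:
  assumes u: "u \<in> pverts G" and v: "v \<in> pverts G"
  shows "interval G u v = {w \<in> pverts G. hops G u v = hops G u w + hops G w v}"
proof (intro set_eqI iffI)
  fix w assume "w \<in> interval G u v"
  then obtain p where p: "apath u p v" "length p = hops G u v" "w \<in> set (pawalk_verts u p)"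
    using gdist_eq_hops[OF u v] by (auto simp: interval_def)
  then have "awalk u p v" by (simp add: apath_def)
  then obtain q r where qr: "p = q @ r" "awalk u q w" "awalk w r v"
    using awalk_decomp[of u p v w] p(3) by auto
  then have w: "w \<in> pverts G" by auto
  then show "w \<in> {w \<in> pverts G. hops G u v = hops G u w + hops G w v}"
    using qr p(2) hops_awalk_le[of u q w] hops_awalk_le[of w r v] hops_triangle[OF u w v] by auto
next
  fix w assume "w \<in> {w \<in> pverts G. hops G u v = hops G u w + hops G w v}"
  then have w: "w \<in> pverts G" and sum: "hops G u v = hops G u w + hops G w v" by auto
  obtain q where q: "awalk u q w" "length q = hops G u w" using hops_awalk_ex[OF u w] .
  obtain r where r: "awalk w r v" "length r = hops G w v" using hops_awalk_ex[OF w v] .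
  have walk: "awalk u (q @ r) v" and len: "length (q @ r) = hops G u v"
    using q r sum by auto
  \<comment> \<open>A repeated vertex would enclose a closed subwalk of positive length; cutting it
    out would give a walk shorter than the distance.\<close>
  have "distinct (pawalk_verts u (q @ r))"
  proof (rule ccontr)
    assume "\<not> distinct (pawalk_verts u (q @ r))"
    from awalk_not_distinct_decomp[OF walk this] obtain a b c x where
      abc: "q @ r = a @ b @ c" "0 < length b" "awalk u a x" "awalk x c v" by auto
    then have "awalk u (a @ c) v" by auto
    from hops_awalk_le[OF this] have "hops G u v \<le> length a + length c" by simp
    moreover have "hops G u v = length a + length b + length c"
      using len abc(1) by (metis length_append add.assoc)
    ultimately show False using abc(2) by simp
  qed
  then have "apath u (q @ r) v" using walk by (simp add: apath_def)
  moreover have "w \<in> set (pawalk_verts u (q @ r))"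
    using walk q(1) r(1) set_awalk_verts_append[of u q w r v] by (auto simp: awalk_verts_conv)
  ultimately show "w \<in> interval G u v"
    using len gdist_eq_hops[OF u v] by (auto simp: interval_def intro!: exI[of _ "q @ r"])
qed

lemma general_position_iff:
  "general_position G M \<longleftrightarrow> M \<subseteq> pverts G \<and>
     \<not> (\<exists>u\<in>M. \<exists>v\<in>M. \<exists>w\<in>M. u \<noteq> v \<and> u \<noteq> w \<and> v \<noteq> w \<and> hops G u v = hops G u w + hops G w v)"
  unfolding general_position_def
proof (rule conj_cong[OF refl])
  assume "M \<subseteq> pverts G"
  then have "gdist G u v = gdist G u w + gdist G w v \<longleftrightarrow> hops G u v = hops G u w + hops G w v"
    if "u \<in> M" "v \<in> M" "w \<in> M" for u v w
    using that by (simp add: gdist_eq_hops subset_iff flip: of_nat_add)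
  then show "(\<not> (\<exists>u\<in>M. \<exists>v\<in>M. \<exists>w\<in>M. u \<noteq> v \<and> u \<noteq> w \<and> v \<noteq> w \<and> gdist G u v = gdist G u w + gdist G w v)) \<longleftrightarrow>
    (\<not> (\<exists>u\<in>M. \<exists>v\<in>M. \<exists>w\<in>M. u \<noteq> v \<and> u \<noteq> w \<and> v \<noteq> w \<and> hops G u v = hops G u w + hops G w v))"
    by blast
qed

end


section \<open>Distances in Sierpinski triangle graphs\<close>

text \<open>The value \<open>third c c = c\<close> is chosen such that \<open>third b\<close> is the reflection that fixes the corner
  \<open>b\<close>.\<close>

fun third :: "corner \<Rightarrow> corner \<Rightarrow> corner" where
  "third Top Left = Right"
| "third Top Right = Left"
| "third Left Top = Right"
| "third Left Right = Top"
| "third Right Top = Left"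
| "third Right Left = Top"
| "third c _ = c"

lemma third_neq: "c \<noteq> d \<Longrightarrow> third c d \<noteq> c \<and> third c d \<noteq> d"
  by (cases c; cases d) auto

lemma third_cases: "c \<noteq> d \<Longrightarrow> a = c \<or> a = d \<or> a = third c d"
  by (cases c; cases d; cases a) auto

lemma third_same [simp]: "third c c = c"
  by (cases c) auto

lemma third_commute: "third c d = third d c"
  by (cases c; cases d) auto

abbreviation "ST_verts n \<equiv> pverts (graph_of (ST n))"
abbreviation "ST_arcs n \<equiv> parcs (graph_of (ST n))"
abbreviation "ST_dist n \<equiv> hops (graph_of (ST n))"

lemma ST_verts_Suc: "ST_verts (Suc n) = (\<Union>c. inj_copy c ` ST_verts n)"
  by (simp add: copy_of_def)

lemma ST_arcs_Suc: "ST_arcs (Suc n) = (\<Union>c. map_prod (inj_copy c) (inj_copy c) ` ST_arcs n)"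
  by (simp add: copy_of_def)

lemma ST_arcs_0: "(x, y) \<in> ST_arcs 0 \<longleftrightarrow> (\<exists>c d. x = Corner c \<and> y = Corner d \<and> c \<noteq> d)"
  by auto

lemma ST_verts_0: "ST_verts 0 = range Corner"
  by simp

declare ST.simps [simp del]

lemma inj_inj_copy: "inj (inj_copy c)"
  by (simp add: inj_def inj_copy_eq_iff)

lemma inj_copy_Corner_same: "inj_copy c (Corner c) = Corner c"
  by simp

lemma inj_copy_Corner_swap: "inj_copy c (Corner d) = inj_copy d (Corner c)"
  by (auto simp: insert_commute)

lemma inj_copy_in_verts: "x \<in> ST_verts n \<Longrightarrow> inj_copy c x \<in> ST_verts (Suc n)"
  by (auto simp: ST_verts_Suc)

lemma ST_verts_SucE:
  assumes "v \<in> ST_verts (Suc n)"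
  obtains c x where "x \<in> ST_verts n" "v = inj_copy c x"
  using assms by (auto simp: ST_verts_Suc)

lemma Corner_in_verts [simp]: "Corner c \<in> ST_verts n"
proof (induction n)
  case (Suc n)
  then show ?case using inj_copy_in_verts[of "Corner c" n c] by simp
qed (simp add: ST_verts_0)

lemma relpow_inj_copy:
  "(x, y) \<in> ST_arcs n ^^ k \<Longrightarrow> (inj_copy c x, inj_copy c y) \<in> ST_arcs (Suc n) ^^ k"
proof (induction k arbitrary: y)
  case (Suc k)
  from Suc.prems obtain z where "(x, z) \<in> ST_arcs n ^^ k" "(z, y) \<in> ST_arcs n" by auto
  moreover from this(2) have "(inj_copy c z, inj_copy c y) \<in> ST_arcs (Suc n)"
    unfolding ST_arcs_Suc by force
  ultimately show ?case using Suc.IH by auto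
qed simp

text \<open>From copy \<open>d\<close> one goes to the vertex shared with copy \<open>c\<close> (to
  the corner itself if \<open>d = c\<close>) and then on inside copy \<open>c\<close>; each leg
  costs at most \<open>2 ^ n\<close>.\<close>

lemma relpow_to_corner: "u \<in> ST_verts n \<Longrightarrow> \<exists>k\<le>2 ^ n. (u, Corner c) \<in> ST_arcs n ^^ k"
proof (induction n arbitrary: u c)
  case 0
  then obtain d where "u = Corner d" by (auto simp: ST_verts_0)
  moreover have "(Corner d, Corner c) \<in> ST_arcs 0 ^^ (if d = c then 0 else 1)"
    by (auto simp: ST_arcs_0)
  ultimately show ?case
    by (intro exI[of _ "if d = c then 0 else 1"]) auto
next
  case (Suc n)
  from Suc.prems obtain d x where x: "x \<in> ST_verts n" "u = inj_copy d x" by (rule ST_verts_SucE)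
  obtain k where k: "k \<le> 2 ^ n" "(x, Corner c) \<in> ST_arcs n ^^ k"
    using Suc.IH[OF x(1)] by blast
  obtain l where l: "l \<le> 2 ^ n" "(Corner d, Corner c) \<in> ST_arcs n ^^ l"
    using Suc.IH[OF Corner_in_verts] by blast
  have "(u, inj_copy d (Corner c)) \<in> ST_arcs (Suc n) ^^ k"
    using relpow_inj_copy[OF k(2)] x by simp
  moreover have "(inj_copy c (Corner d), inj_copy c (Corner c)) \<in> ST_arcs (Suc n) ^^ l"
    using relpow_inj_copy[OF l(2)] .
  ultimately have "(u, Corner c) \<in> ST_arcs (Suc n) ^^ (k + l)"
    by (auto simp only: relpow_add inj_copy_Corner_same inj_copy_Corner_swap[of d c])
  then show ?case using k(1) l(1) by (intro exI[of _ "k + l"]) simp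
qed

interpretation ST: connected_pair_graph "graph_of (ST n)" for n
proof -
  interpret pair_graph "graph_of (ST n)" by (rule pair_graph_ST)
  have sym: "sym (ST_arcs n ^^ k)" for k
    using pair_sym_arcs by (simp add: symmetric_def sym_relpow)
  show "connected_pair_graph (graph_of (ST n))"
  proof
    fix u v assume "u \<in> ST_verts n" "v \<in> ST_verts n"
    then obtain k l where "(u, Corner Top) \<in> ST_arcs n ^^ k" "(v, Corner Top) \<in> ST_arcs n ^^ l"
      using relpow_to_corner by blast
    then have "(u, v) \<in> ST_arcs n ^^ (k + l)"
      using sym[of l] by (auto simp: relpow_add dest: symD)
    then show "\<exists>k. (u, v) \<in> ST_arcs n ^^ k" ..
  qed
qed

lemma dist_corner_le: "u \<in> ST_verts n \<Longrightarrow> ST_dist n u (Corner c) \<le> 2 ^ n"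
  using relpow_to_corner[of u n c] hops_le by (metis order_trans)

lemma dist_inj_copy_le:
  "\<lbrakk>x \<in> ST_verts n; y \<in> ST_verts n\<rbrakk> \<Longrightarrow>
     ST_dist (Suc n) (inj_copy c x) (inj_copy c y) \<le> ST_dist n x y"
  by (rule hops_le, rule relpow_inj_copy, rule ST.relpow_hops)

lemma dist_copies_le:
  assumes "x \<in> ST_verts n" "y \<in> ST_verts n"
  shows "ST_dist (Suc n) (inj_copy c x) (inj_copy d y)
     \<le> ST_dist n x (Corner d) + ST_dist n (Corner c) y"
proof -
  have "ST_dist (Suc n) (inj_copy c x) (inj_copy d y) \<le>
      ST_dist (Suc n) (inj_copy c x) (inj_copy c (Corner d)) +
      ST_dist (Suc n) (inj_copy d (Corner c)) (inj_copy d y)"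
    unfolding inj_copy_Corner_swap[of d c]
    by (intro ST.hops_triangle inj_copy_in_verts assms Corner_in_verts)
  also have "\<dots> \<le> ST_dist n x (Corner d) + ST_dist n (Corner c) y"
    by (intro add_mono dist_inj_copy_le assms Corner_in_verts)
  finally show ?thesis .
qed

section \<open>The distance formula for glued copies\<close>

definition copy_dist :: "nat \<Rightarrow> corner \<Rightarrow> vertex \<Rightarrow> corner \<Rightarrow> vertex \<Rightarrow> nat" where
  "copy_dist n c x d y = (if c = d then ST_dist n x y else
     min (ST_dist n x (Corner d) + ST_dist n (Corner c) y)
         (ST_dist n x (Corner (third c d)) + 2 ^ n + ST_dist n (Corner (third c d)) y))"

lemma dist_Suc_le:
  assumes "x \<in> ST_verts n" "y \<in> ST_verts n"
  shows "ST_dist (Suc n) (inj_copy c x) (inj_copy d y) \<le> copy_dist n c x d y"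
proof (cases "c = d")
  case True
  then show ?thesis using dist_inj_copy_le assms by (simp add: copy_dist_def)
next
  case False
  define e where "e = third c d"
  have "ST_dist (Suc n) (inj_copy c x) (inj_copy d y) \<le>
      ST_dist (Suc n) (inj_copy c x) (inj_copy e (Corner d)) +
      ST_dist (Suc n) (inj_copy d (Corner e)) (inj_copy d y)"
    unfolding inj_copy_Corner_swap[of d e]
    by (intro ST.hops_triangle inj_copy_in_verts assms Corner_in_verts)
  also have "\<dots> \<le> (ST_dist n x (Corner e) + ST_dist n (Corner c) (Corner d)) + ST_dist n (Corner e) y"
    by (intro add_mono dist_inj_copy_le dist_copies_le assms Corner_in_verts)
  also have "\<dots> \<le> ST_dist n x (Corner e) + 2 ^ n + ST_dist n (Corner e) y"
    by (simp add: dist_corner_le)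
  finally show ?thesis
    using False dist_copies_le[OF assms, of c d] by (simp add: copy_dist_def e_def)
qed

text \<open>A gluing vertex has two coordinates, \<open>Corner b\<close> in copy \<open>a\<close>
  and \<open>Corner a\<close> in copy \<open>b\<close>, and the formula must agree on them. The
  corner distances are a hypothesis because \<open>dist_corners\<close> is proved by an induction
  that uses the formula.\<close>

lemma copy_dist_glue:
  assumes x: "x \<in> ST_verts n" and corner: "\<And>c d. c \<noteq> d \<Longrightarrow> ST_dist n (Corner c) (Corner d) = 2 ^ n"
  shows "copy_dist n c x a (Corner b) = copy_dist n c x b (Corner a)"
proof (cases "a = b")
  case False
  have tri: "ST_dist n x (Corner d) \<le> ST_dist n x (Corner e) + 2 ^ n" if "d \<noteq> e" for d e
    using ST.hops_triangle[OF x Corner_in_verts Corner_in_verts, of d e] corner[of d e] that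
    ST.hops_triangle[OF x Corner_in_verts Corner_in_verts, of e d] corner[of e d] by auto
  show ?thesis
  proof (cases "c = a \<or> c = b")
    case True
    then show ?thesis
      using False tri[of b "third a b"] tri[of a "third b a"] third_neq[of a b] third_neq[of b a]
      by (auto simp: copy_dist_def corner)
  next
    case c: False
    then have "third c a = b" "third c b = a"
      using False by (cases c; cases a; cases b; simp)+
    then show ?thesis
      using c False by (auto simp: copy_dist_def corner)
  qed
qed simp

lemma copy_dist_step:
  assumes x: "x \<in> ST_verts n" and y: "y \<in> ST_verts n" and z: "z \<in> ST_verts n"
  shows "copy_dist n c x d z \<le> copy_dist n c x d y + ST_dist n y z"
  using ST.hops_triangle[OF x y z] ST.hops_triangle[OF Corner_in_verts[of c] y z]
    ST.hops_triangle[OF Corner_in_verts[of "third c d"] y z]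
  by (simp add: copy_dist_def min_def)

text \<open>The lower bound for the distance. Each arc lies in one copy, so the formula grows by at
  most 1 per arc; \<open>copy_dist_glue\<close> changes coordinates where a walk passes into another
  copy.\<close>

lemma copy_dist_le_relpow:
  assumes x: "x \<in> ST_verts n" and corner: "\<And>c d. c \<noteq> d \<Longrightarrow> ST_dist n (Corner c) (Corner d) = 2 ^ n"
  shows "\<lbrakk>(inj_copy c x, inj_copy d y) \<in> ST_arcs (Suc n) ^^ k; y \<in> ST_verts n\<rbrakk>
    \<Longrightarrow> copy_dist n c x d y \<le> k"
proof (induction k arbitrary: d y)
  case 0
  then show ?case using copy_dist_glue[OF x corner, of c c d]
    by (auto simp: inj_copy_eq_iff copy_dist_def corner)
next
  case (Suc k)
  then obtain v where v: "(inj_copy c x, v) \<in> ST_arcs (Suc n) ^^ k" "(v, inj_copy d y) \<in> ST_arcs (Suc n)"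
    by auto
  then obtain b p q where b: "(p, q) \<in> ST_arcs n" "v = inj_copy b p" "inj_copy d y = inj_copy b q"
    by (auto simp: ST_arcs_Suc)
  have pq: "p \<in> ST_verts n" "q \<in> ST_verts n"
    using b(1) ST.in_arcsD1 ST.in_arcsD2 by blast+
  have "ST_dist n p q \<le> 1"
    using hops_le[of p q 1 "graph_of (ST n)"] b(1) by simp
  moreover have "copy_dist n c x b p \<le> k"
    using Suc.IH v(1) b(2) pq by simp
  ultimately have "copy_dist n c x b q \<le> Suc k"
    using copy_dist_step[OF x pq, of c b] by linarith
  moreover have "copy_dist n c x d y = copy_dist n c x b q"
    using b(3) copy_dist_glue[OF x corner, of c d b] by (auto simp: inj_copy_eq_iff)
  ultimately show ?case by simp
qed

lemma dist_Suc_if: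
  assumes "x \<in> ST_verts n" "y \<in> ST_verts n"
    and "\<And>c d. c \<noteq> d \<Longrightarrow> ST_dist n (Corner c) (Corner d) = 2 ^ n"
  shows "ST_dist (Suc n) (inj_copy c x) (inj_copy d y) = copy_dist n c x d y"
  by (intro antisym dist_Suc_le copy_dist_le_relpow ST.relpow_hops inj_copy_in_verts assms)

text \<open>At depth \<open>Suc n\<close> the direct route between two corners costs twice
  \<open>2 ^ n\<close> and the detour through the third copy three times
  \<open>2 ^ n\<close>.\<close>

lemma dist_corners: "c \<noteq> d \<Longrightarrow> ST_dist n (Corner c) (Corner d) = 2 ^ n"
proof (induction n arbitrary: c d)
  case 0
  have "(Corner c, Corner d) \<in> ST_arcs 0 ^^ 1"
    using 0 by (auto simp: ST_arcs_0)
  then have "ST_dist 0 (Corner c) (Corner d) \<le> 1" by (rule hops_le)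
  moreover have "ST_dist 0 (Corner c) (Corner d) \<noteq> 0"
    using 0 by (simp add: ST.hops_eq_0_iff)
  ultimately show ?case by simp
next
  case (Suc n)
  have "ST_dist (Suc n) (Corner c) (Corner d) = copy_dist n c (Corner c) d (Corner d)"
    using dist_Suc_if[of "Corner c" n "Corner d" c d] Suc.IH by simp
  then show ?case
    using Suc third_neq[OF Suc.prems] by (simp add: copy_dist_def)
qed

lemma dist_Suc:
  assumes "x \<in> ST_verts n" "y \<in> ST_verts n"
  shows "ST_dist (Suc n) (inj_copy c x) (inj_copy d y) = copy_dist n c x d y"
  using dist_Suc_if dist_corners assms by blast

section \<open>Exhaustive search for independent sets\<close>

text \<open>A tableau entry \<open>(x, d, r)\<close> says whether the candidate \<open>x\<close> is dead, and \<open>r\<close> lists for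
  each later candidate \<open>y\<close> whether the pair \<open>{x, y}\<close> is forbidden and for which candidates \<open>z\<close> after
  \<open>y\<close> the triple \<open>{x, y, z}\<close> is forbidden. Choosing \<open>x\<close> turns the pairs of \<open>x\<close> into dead candidates and
  the triples into pairs.\<close>

fun rows :: "('a \<Rightarrow> bool) \<Rightarrow> ('a \<Rightarrow> 'a \<Rightarrow> bool) \<Rightarrow> 'a list \<Rightarrow> (bool \<times> bool list) list" where
  "rows p q [] = []"
| "rows p q (y # ys) = (p y, map (q y) ys) # rows p q ys"

fun tableau :: "('a \<Rightarrow> bool) \<Rightarrow> ('a \<Rightarrow> 'a \<Rightarrow> bool) \<Rightarrow> ('a \<Rightarrow> 'a \<Rightarrow> 'a \<Rightarrow> bool) \<Rightarrow> 'a list \<Rightarrow>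
    ('a \<times> bool \<times> (bool \<times> bool list) list) list" where
  "tableau d p q [] = []"
| "tableau d p q (x # xs) = (x, d x, rows (p x) (q x) xs) # tableau d p q xs"

fun merge :: "bool list \<Rightarrow> (bool \<times> bool list) list \<Rightarrow> (bool \<times> bool list) list" where
  "merge (g # gs) ((f, h) # fs) = (f \<or> g, h) # merge gs fs"
| "merge _ _ = []"

fun select :: "(bool \<times> bool list) list \<Rightarrow> ('a \<times> bool \<times> (bool \<times> bool list) list) list \<Rightarrow>
    ('a \<times> bool \<times> (bool \<times> bool list) list) list" where
  "select ((f, g) # rs) ((y, d, r) # st) = (y, d \<or> f, merge g r) # select rs st"
| "select _ _ = []"

lemma length_select [termination_simp]: "length (select rs st) \<le> length st"
  by (induction rs st rule: select.induct) auto

text \<open>\<open>k\<close> counts the choices still owed. Truncated subtraction keeps it at 0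
  afterwards, so larger sets are listed too. A branch is cut once fewer than \<open>k\<close>
  candidates are alive.\<close>

fun search :: "('a \<times> bool \<times> (bool \<times> bool list) list) list \<Rightarrow> nat \<Rightarrow> 'a list list" where
  "search [] k = (if k = 0 then [[]] else [])"
| "search ((x, d, r) # st) k =
     (if length (filter (\<lambda>(_, d', _). \<not> d') ((x, d, r) # st)) < k then []
      else (if d then [] else map ((#) x) (search (select r st) (k - 1))) @ search st k)"

lemma merge_rows: "merge (map g ys) (rows p q ys) = rows (\<lambda>y. p y \<or> g y) q ys"
  by (induction ys) auto

lemma select_tableau:
  "select (rows r s xs) (tableau d p q xs) = tableau (\<lambda>y. d y \<or> r y) (\<lambda>y z. p y z \<or> s y z) q xs"
  by (induction xs) (auto simp: merge_rows)

lemma length_alive_tableau: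
  "length (filter (\<lambda>(_, d', _). \<not> d') (tableau d p q xs)) = length (filter (\<lambda>x. \<not> d x) xs)"
  by (induction xs) auto

text \<open>All elements of \<open>S\<close> are alive candidates, so the cut never loses
  \<open>S\<close>. The induction generalises \<open>d\<close> and \<open>p\<close> because choosing
  \<open>x\<close> moves its pairs into \<open>d\<close> and its triples into
  \<open>p\<close>.\<close>

lemma search_complete:
  assumes "S \<subseteq> set xs" "distinct xs" "k \<le> card S" "\<And>x. x \<in> S \<Longrightarrow> \<not> d x"
    and "\<And>x y. \<lbrakk>x \<in> S; y \<in> S; x \<noteq> y\<rbrakk> \<Longrightarrow> \<not> p x y"
    and "\<And>x y z. \<lbrakk>x \<in> S; y \<in> S; z \<in> S; x \<noteq> y; x \<noteq> z; y \<noteq> z\<rbrakk> \<Longrightarrow> \<not> q x y z"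
  shows "\<exists>l \<in> set (search (tableau d p q xs) k). set l = S \<and> distinct l"
  using assms
proof (induction xs arbitrary: S k d p)
  case Nil
  then show ?case by auto
next
  case (Cons x xs)
  let ?alive = "filter (\<lambda>x. \<not> d x) (x # xs)"
  have "S \<subseteq> set ?alive" using Cons.prems(1,4) by auto
  then have "card S \<le> length ?alive"
    by (meson card_length card_mono finite_set order_trans)
  then have len: "\<not> length (filter (\<lambda>(_, d', _). \<not> d') (tableau d p q (x # xs))) < k"
    using Cons.prems(3) unfolding length_alive_tableau by linarith
  show ?case
  proof (cases "x \<in> S")
    case True
    let ?d = "\<lambda>y. d y \<or> p x y" and ?p = "\<lambda>y z. p y z \<or> q x y z"
    have "\<exists>l \<in> set (search (tableau ?d ?p q xs) (k - 1)). set l = S - {x} \<and> distinct l"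
    proof (rule Cons.IH)
      show "k - 1 \<le> card (S - {x})"
        using Cons.prems(3) True by (simp add: card_Diff_singleton)
    qed (use Cons.prems True in auto)
    then obtain l where "l \<in> set (search (tableau ?d ?p q xs) (k - 1))" "set l = S - {x}" "distinct l"
      by blast
    then show ?thesis
      using len Cons.prems(4)[OF True] True
      by (intro bexI[of _ "x # l"]) (auto simp: select_tableau)
  next
    case False
    have "\<exists>l \<in> set (search (tableau d p q xs) k). set l = S \<and> distinct l"
      by (rule Cons.IH) (use Cons.prems False in auto)
    then show ?thesis
      using len by auto
  qed
qed


section \<open>Depths one and two\<close>

text \<open>The word \<open>[a, b, c]\<close> stands for the vertex \<open>inj_copy a (inj_copy b (Corner c))\<close>. The lists
  \<open>words1\<close> and \<open>words2\<close> contain one word for each vertex.\<close>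

fun corner_dist :: "corner \<Rightarrow> corner list \<Rightarrow> nat" where
  "corner_dist d [] = 0"
| "corner_dist d (c # x) = corner_dist d x + (if c = d then 0 else 2 ^ (length x - 1))"

fun word_dist :: "corner list \<Rightarrow> corner list \<Rightarrow> nat" where
  "word_dist (c # x) (d # y) =
     (if c = d then word_dist x y
      else if x = [] then 1
      else min (corner_dist d x + corner_dist c y)
             (corner_dist (third c d) x + 2 ^ (length x - 1) + corner_dist (third c d) y))"
| "word_dist _ _ = 0"

definition word_between :: "corner list \<Rightarrow> corner list \<Rightarrow> corner list \<Rightarrow> bool" where
  "word_between u w v \<longleftrightarrow> word_dist u v = word_dist u w + word_dist w v"

definition word_collinear :: "corner list \<Rightarrow> corner list \<Rightarrow> corner list \<Rightarrow> bool" where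
  "word_collinear x y z \<longleftrightarrow> word_between y x z \<or> word_between x y z \<or> word_between x z y"

text \<open>The violation, by the pair \<open>y\<close>, \<open>z\<close>, of the condition that
  \<open>guard\<close> states below for vertices; \<open>k\<close> is the slack.\<close>

definition word_shadow :: "nat \<Rightarrow> corner \<Rightarrow> corner \<Rightarrow> corner list \<Rightarrow> corner list \<Rightarrow> bool" where
  "word_shadow k a e y z \<longleftrightarrow>
     word_between [a, a, a] y z \<and> word_dist [a, a, a] z \<le> word_dist [e, e, e] z + k"

abbreviation corners :: "corner list" where "corners \<equiv> [Top, Left, Right]"

definition words2 :: "corner list list" where
  "words2 =
     [[Top, Top, Top], [Top, Top, Left], [Top, Top, Right], [Top, Left, Right], [Top, Left, Left],
      [Top, Right, Right], [Left, Left, Left], [Left, Left, Top], [Left, Left, Right],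
      [Left, Top, Right], [Left, Right, Right], [Right, Right, Right], [Right, Right, Top],
      [Right, Right, Left], [Right, Top, Left]]"

text \<open>Bound and uniqueness in one test: no listed set is larger than allowed, and each one
  either breaks a guard with slack 2 or is the extremal set without the corners in
  \<open>A\<close>.\<close>

definition depth2_ok :: "corner list list list \<Rightarrow> corner \<Rightarrow> corner list \<Rightarrow> bool" where
  "depth2_ok Ss b A \<longleftrightarrow>
     (\<forall>S \<in> set Ss.
        length S + length A = 6 \<and>
        ((\<exists>a \<in> set A. \<exists>y \<in> set S. \<exists>z \<in> set S. y \<noteq> z \<and> word_shadow 2 a (third b a) y z) \<or>
         set S = set ([[Top,Left,Right],[Left,Top,Right],[Right,Top,Left]] @ map (\<lambda>c. [c,c,c]) (filter (\<lambda>c. c \<notin> set A) corners))))"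

text \<open>\<open>b\<close> is the position of the graph as a copy one level up:
  \<open>third b a\<close> is the other inner corner for \<open>a \<noteq> b\<close>, while
  \<open>third b b = b\<close> makes the guard at the outer corner a full one. The pair relation is
  symmetrised because a tableau asks it in list order only.\<close>

lemma depth2_search:
  "\<forall>b \<in> set corners. \<forall>A \<in> set (subseqs corners). depth2_ok
     (search (tableau (\<lambda>_. False)
       (\<lambda>y z. \<exists>a\<in>set A. word_shadow 0 a (third b a) y z \<or> word_shadow 0 a (third b a) z y)
       word_collinear words2) (6 - length A)) b A"
  by code_simp

definition words1 :: "corner list list" where
  "words1 = [[Top,Top],[Top,Left],[Top,Right],[Left,Left],[Left,Right],[Right,Right]]"

lemma depth1_search:
  "search (tableau (\<lambda>_. False) (\<lambda>_ _. False) word_collinear words1) 4 = []"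
  by code_simp

section \<open>Words as coordinates of vertices\<close>

definition between :: "nat \<Rightarrow> vertex \<Rightarrow> vertex \<Rightarrow> vertex \<Rightarrow> bool" where
  "between n u w v \<longleftrightarrow> ST_dist n u v = ST_dist n u w + ST_dist n w v"

abbreviation "gpos n \<equiv> general_position (graph_of (ST n))"

lemma gpos_iff:
  "gpos n M \<longleftrightarrow> M \<subseteq> ST_verts n \<and>
     (\<forall>u\<in>M. \<forall>v\<in>M. \<forall>w\<in>M. u \<noteq> v \<longrightarrow> u \<noteq> w \<longrightarrow> v \<noteq> w \<longrightarrow> \<not> between n u w v)"
  unfolding ST.general_position_iff between_def by blast

lemma between_inj_copy:
  "\<lbrakk>x \<in> ST_verts n; y \<in> ST_verts n; z \<in> ST_verts n\<rbrakk> \<Longrightarrow>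
     between (Suc n) (inj_copy c x) (inj_copy c y) (inj_copy c z) \<longleftrightarrow> between n x y z"
  by (simp add: between_def dist_Suc copy_dist_def)

text \<open>With \<open>e = a\<close> the guard condition says that no two points of \<open>M\<close> are collinear with a point
  outside the graph that is attached to corner \<open>a\<close>. With \<open>e \<noteq> a\<close> the outside point may also
  reach the graph through corner \<open>e\<close>, and the condition only holds for those \<open>z\<close> which
  it certainly reaches through \<open>a\<close>.\<close>

definition guard :: "nat \<Rightarrow> nat \<Rightarrow> corner \<Rightarrow> corner \<Rightarrow> vertex set \<Rightarrow> bool" where
  "guard n k a e M \<longleftrightarrow> (\<forall>y\<in>M. \<forall>z\<in>M. y \<noteq> z \<and> between n (Corner a) y z \<longrightarrow>
     ST_dist n (Corner e) z + k < ST_dist n (Corner a) z)"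

fun vert :: "corner list \<Rightarrow> vertex" where
  "vert [c] = Corner c"
| "vert (c # w) = inj_copy c (vert w)"
| "vert [] = undefined"

lemma vert_Cons: "length w = Suc n \<Longrightarrow> vert (c # w) = inj_copy c (vert w)"
  by (cases w) auto

lemma vert_in_verts: "length w = Suc n \<Longrightarrow> vert w \<in> ST_verts n"
proof (induction n arbitrary: w)
  case 0
  then show ?case by (auto simp: length_Suc_conv)
next
  case (Suc n)
  then obtain c v where "w = c # v" "length v = Suc n" by (auto simp: length_Suc_conv)
  then show ?case using Suc.IH[of v] inj_copy_in_verts vert_Cons[of v n c] by auto
qed

lemma dist_vert_corner: "length w = Suc n \<Longrightarrow> ST_dist n (vert w) (Corner d) = corner_dist d w"
proof (induction n arbitrary: w)
  case 0
  then show ?case by (auto simp: length_Suc_conv dist_corners)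
next
  case (Suc n)
  then obtain c v where w: "w = c # v" "length v = Suc n" by (auto simp: length_Suc_conv)
  have v: "vert v \<in> ST_verts n" using vert_in_verts w by blast
  have "ST_dist (Suc n) (vert w) (Corner d) = copy_dist n c (vert v) d (Corner d)"
    using dist_Suc[OF v Corner_in_verts, of c d d] w vert_Cons[of v n c] by auto
  also have "\<dots> = corner_dist d w"
    using w Suc.IH[of v] third_neq[of c d] dist_corner_le[OF v, of d]
    by (auto simp: copy_dist_def dist_corners)
  finally show ?case .
qed

lemma dist_vert:
  "\<lbrakk>length v = Suc n; length w = Suc n\<rbrakk> \<Longrightarrow> ST_dist n (vert v) (vert w) = word_dist v w"
proof (induction n arbitrary: v w)
  case 0
  then show ?case by (auto simp: length_Suc_conv dist_corners)
next
  case (Suc n)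
  then obtain c x d y where xy: "v = c # x" "length x = Suc n" "w = d # y" "length y = Suc n"
    by (auto simp: length_Suc_conv)
  have "ST_dist (Suc n) (vert v) (vert w) = copy_dist n c (vert x) d (vert y)"
    using dist_Suc[of "vert x" n "vert y" c d] vert_in_verts xy vert_Cons[of x n c] vert_Cons[of y n d] by auto
  also have "\<dots> = word_dist v w"
    using xy Suc.IH[of x y] ST.hops_commute[of _ "Corner _" "vert y"]
    by (auto simp: copy_dist_def dist_vert_corner)
  finally show ?case .
qed

lemma between_vert:
  "\<lbrakk>length u = Suc n; length v = Suc n; length w = Suc n\<rbrakk> \<Longrightarrow>
     between n (vert u) (vert v) (vert w) \<longleftrightarrow> word_between u v w"
  by (simp add: between_def word_between_def dist_vert)

lemma between_commute: "between n u w v \<longleftrightarrow> between n v w u"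
  unfolding between_def using ST.hops_commute by (metis add.commute)

lemma ST_verts_1: "ST_verts 1 = vert ` set words1"
  using ST_verts_Suc[of 0] by (auto simp: words1_def ST_verts_0 UNIV_corner insert_commute)

lemma ST_verts_2: "ST_verts 2 = vert ` set words2"
  using ST_verts_Suc[of 1] ST_verts_1
  by (auto simp: words1_def words2_def UNIV_corner insert_commute numeral_2_eq_2)

lemma length_words1: "w \<in> set words1 \<Longrightarrow> length w = Suc 1"
  by (auto simp: words1_def)

lemma length_words2: "w \<in> set words2 \<Longrightarrow> length w = Suc 2"
  by (auto simp: words2_def)

lemma inj_on_vert: "inj_on vert (set words1)" "inj_on vert (set words2)"
  by (auto simp: words1_def words2_def doubleton_eq_iff)

lemma distinct_words: "distinct words1" "distinct words2"
  by (simp_all add: words1_def words2_def)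

lemma not_collinear:
  assumes M: "gpos n M" and W: "\<And>w. w \<in> W \<Longrightarrow> length w = Suc n" "inj_on vert W"
    and "x \<in> W" "y \<in> W" "z \<in> W" "vert x \<in> M" "vert y \<in> M" "vert z \<in> M" "x \<noteq> y" "x \<noteq> z" "y \<noteq> z"
  shows "\<not> word_collinear x y z"
proof -
  have "vert x \<noteq> vert y" "vert x \<noteq> vert z" "vert y \<noteq> vert z"
    using assms by (auto dest: inj_onD)
  then show ?thesis
    using assms unfolding word_collinear_def
    by (auto simp: gpos_iff between_vert[symmetric])
qed

lemma card_gpos_1:
  assumes "gpos 1 M"
  shows "card M \<le> 3"
proof (rule ccontr)
  assume "\<not> card M \<le> 3"
  define S where "S = {w \<in> set words1. vert w \<in> M}"
  have "M = vert ` S"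
    using assms ST_verts_1 by (auto simp: gpos_iff S_def)
  moreover have "inj_on vert S"
    using inj_on_vert(1) by (rule inj_on_subset) (auto simp: S_def)
  ultimately have "4 \<le> card S"
    using \<open>\<not> card M \<le> 3\<close> by (simp add: card_image)
  then have "\<exists>l \<in> set (search (tableau (\<lambda>_. False) (\<lambda>_ _. False) word_collinear words1) 4).
      set l = S \<and> distinct l"
    using not_collinear[OF assms length_words1 inj_on_vert(1)] distinct_words
    by (intro search_complete) (auto simp: S_def)
  then show False by (simp add: depth1_search)
qed

definition proper2 :: "vertex set" where
  "proper2 = vert ` {[Top, Left, Right], [Left, Top, Right], [Right, Top, Left]}"

text \<open>The base case of the upper bound. In terms of words, general position and guards say
  that \<open>S\<close> avoids the forbidden triples and pairs of the evaluated search.\<close>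

lemma gpos_2:
  assumes M: "gpos 2 M" and guard: "\<And>a. a \<in> A \<Longrightarrow> guard 2 0 a (third b a) M"
  shows "card M + card A \<le> 6"
    and "\<lbrakk>card M + card A = 6; \<And>a. a \<in> A \<Longrightarrow> guard 2 2 a (third b a) M\<rbrakk> \<Longrightarrow>
      M = proper2 \<union> Corner ` (- A)"
proof -
  define S where "S = {w \<in> set words2. vert w \<in> M}"
  have M_eq: "M = vert ` S"
    using M ST_verts_2 by (auto simp: gpos_iff S_def)
  have inj: "inj_on vert S"
    using inj_on_vert(2) by (rule inj_on_subset) (auto simp: S_def)
  then have card_M: "card M = card S"
    using M_eq by (simp add: card_image)
  \<comment> \<open>The evaluated instances run over subsequences of \<open>corners\<close>, so
    \<open>A\<close> has to be presented by one of them.\<close>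
  have "A \<in> set ` set (subseqs corners)"
    by (simp only: subseqs_powset) (simp add: UNIV_corner[symmetric])
  then obtain As where As: "As \<in> set (subseqs corners)" "set As = A" by blast
  have "distinct As"
    using subseqs_distinctD[OF As(1)] by simp
  then have card_A: "card A = length As"
    using As by (simp add: distinct_card[symmetric])
  have no_shadow: "\<not> word_shadow k a (third b a) y z"
    if "guard 2 k a (third b a) M" "y \<in> S" "z \<in> S" "y \<noteq> z" for k a y z
  proof -
    have yz: "vert y \<in> M" "vert z \<in> M" "vert y \<noteq> vert z" "length y = Suc 2" "length z = Suc 2"
      using that inj length_words2 by (auto simp: S_def dest: inj_onD)
    have "ST_dist 2 (Corner c) (vert z) = word_dist [c, c, c] z" for c
      using dist_vert[of "[c, c, c]" 2 z] yz by simp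
    moreover have "between 2 (Corner a) (vert y) (vert z) \<longleftrightarrow> word_between [a, a, a] y z"
      using between_vert[of "[a, a, a]" 2 y z] yz by simp
    ultimately show ?thesis
      using that(1) yz(1-3) unfolding guard_def word_shadow_def by fastforce
  qed
  let ?p = "\<lambda>y z. \<exists>a\<in>set As. word_shadow 0 a (third b a) y z \<or> word_shadow 0 a (third b a) z y"
  let ?found = "search (tableau (\<lambda>_. False) ?p word_collinear words2) (6 - length As)"
  have ok: "depth2_ok ?found b As"
    using depth2_search As(1) by (cases b) auto
  \<comment> \<open>This serves both claims: the search also lists sets larger than its target size,
    and \<open>depth2_ok\<close> excludes those.\<close>
  have found: "\<exists>l \<in> set ?found. set l = S \<and> distinct l" if "6 \<le> card M + card A"
  proof (rule search_complete)
    show "6 - length As \<le> card S" using that card_M card_A by simp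
    show "\<not> ?p x y" if "x \<in> S" "y \<in> S" "x \<noteq> y" for x y
      using no_shadow[OF guard] that As(2) by blast
    show "\<not> word_collinear x y z"
      if "x \<in> S" "y \<in> S" "z \<in> S" "x \<noteq> y" "x \<noteq> z" "y \<noteq> z" for x y z
      using not_collinear[OF M length_words2 inj_on_vert(2)] that by (auto simp: S_def)
  qed (auto simp: S_def distinct_words)
  show "card M + card A \<le> 6"
  proof (rule ccontr)
    assume "\<not> card M + card A \<le> 6"
    then obtain l where l: "l \<in> set ?found" "set l = S" "distinct l" using found by auto
    then have "length l + length As = 6" using ok by (auto simp: depth2_ok_def)
    then show False
      using \<open>\<not> card M + card A \<le> 6\<close> l card_M card_A distinct_card[of l] by simp
  qed
  assume "card M + card A = 6" and guard2: "\<And>a. a \<in> A \<Longrightarrow> guard 2 2 a (third b a) M"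
  then obtain l where l: "l \<in> set ?found" "set l = S" using found by auto
  have "\<not> (\<exists>a\<in>set As. \<exists>y\<in>set l. \<exists>z\<in>set l. y \<noteq> z \<and> word_shadow 2 a (third b a) y z)"
    using no_shadow[OF guard2] As(2) l(2) by blast
  from disjE[OF conjunct2[OF bspec[OF ok[unfolded depth2_ok_def] l(1)]] notE[OF this]]
  have S_eq: "S = set ([[Top, Left, Right], [Left, Top, Right], [Right, Top, Left]] @
      map (\<lambda>c. [c, c, c]) (filter (\<lambda>c. c \<notin> set As) corners))"
    unfolding l(2) by blast
  have "S = {[Top, Left, Right], [Left, Top, Right], [Right, Top, Left]} \<union> (\<lambda>c. [c, c, c]) ` (- A)"
  proof -
    have "set (filter (\<lambda>c. c \<notin> set As) corners) = - A"
      unfolding set_filter As(2) list.set UNIV_corner[symmetric] by blast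
    with S_eq show ?thesis
      by (simp only: set_append set_map list.set)
  qed
  then show "M = proper2 \<union> Corner ` (- A)"
    unfolding M_eq proper2_def by (simp add: image_Un image_image)
qed

section \<open>The upper bound\<close>

definition central :: "nat \<Rightarrow> vertex set" where
  "central n = (\<Union>H \<in> copies 2 n. proper_vertices (graph_of (ST n)) H)"

lemma copies_verts:
  "H \<in> copies m n \<Longrightarrow> pverts (graph_of H) \<subseteq> ST_verts n \<and> range (extreme H) \<subseteq> ST_verts n"
proof (induction n arbitrary: H)
  case 0
  then show ?case by (auto simp: extreme_ST split: if_splits)
next
  case (Suc n)
  show ?case
  proof (cases "m = Suc n")
    case True
    with Suc.prems show ?thesis by (auto simp: extreme_ST)
  next
    case False
    with Suc.prems obtain c K where "K \<in> copies m n" "H = copy_of c K" by auto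
    with Suc.IH[of K] show ?thesis
      by (auto simp: copy_of_def intro!: inj_copy_in_verts)
  qed
qed

lemma interval_iff_between:
  "\<lbrakk>u \<in> ST_verts n; v \<in> ST_verts n\<rbrakk> \<Longrightarrow>
     w \<in> interval (graph_of (ST n)) u v \<longleftrightarrow> w \<in> ST_verts n \<and> between n u w v"
  by (simp add: ST.interval_eq between_def)

text \<open>Passing to a copy in the larger graph preserves distances, hence also the part of each
  ambient interval that lies in \<open>H\<close>.\<close>

lemma proper_vertices_copy_of:
  assumes "H \<in> copies m n"
  shows "proper_vertices (graph_of (ST (Suc n))) (copy_of c H) =
    inj_copy c ` proper_vertices (graph_of (ST n)) H"
proof -
  have ext: "extreme H a \<in> ST_verts n" for a
    using copies_verts[OF assms] by auto
  have "inj_copy c x \<in> interval (graph_of (ST (Suc n))) (inj_copy c (extreme H a)) (inj_copy c (extreme H b))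
      \<longleftrightarrow> x \<in> interval (graph_of (ST n)) (extreme H a) (extreme H b)"
    if "x \<in> pverts (graph_of H)" for x a b
    using that copies_verts[OF assms] ext
    by (auto simp: interval_iff_between inj_copy_in_verts between_inj_copy)
  then show ?thesis
    unfolding proper_vertices_def by (auto simp: copy_of_def)
qed

lemma central_Suc: "2 \<le> n \<Longrightarrow> central (Suc n) = (\<Union>c. inj_copy c ` central n)"
proof -
  assume "2 \<le> n"
  then have "central (Suc n) =
      (\<Union>c. \<Union>H \<in> copies 2 n. proper_vertices (graph_of (ST (Suc n))) (copy_of c H))"
    unfolding central_def by auto
  also have "\<dots> = (\<Union>c. inj_copy c ` central n)"
    by (simp add: proper_vertices_copy_of central_def image_UN)
  finally show ?thesis .
qed

lemma central_2: "central 2 = proper2"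
proof -
  have "copies 2 2 = {ST 2}" by (simp add: numeral_2_eq_2)
  then have "central 2 = {v \<in> ST_verts 2. \<not> between 2 (Corner Top) v (Corner Left) \<and>
      \<not> between 2 (Corner Top) v (Corner Right) \<and> \<not> between 2 (Corner Left) v (Corner Right)}"
    by (auto simp: central_def proper_vertices_def extreme_ST interval_iff_between)
  also have "\<dots> = vert ` {w \<in> set words2. \<not> word_between [Top, Top, Top] w [Left, Left, Left] \<and>
      \<not> word_between [Top, Top, Top] w [Right, Right, Right] \<and>
      \<not> word_between [Left, Left, Left] w [Right, Right, Right]}"
  proof -
    have "between 2 (Corner a) (vert w) (Corner b) \<longleftrightarrow> word_between [a, a, a] w [b, b, b]"
      if "w \<in> set words2" for a b w
      using between_vert[of "[a, a, a]" 2 w "[b, b, b]"] length_words2[OF that] by simp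
    then show ?thesis unfolding ST_verts_2 by blast
  qed
  also have "{w \<in> set words2. \<not> word_between [Top, Top, Top] w [Left, Left, Left] \<and>
      \<not> word_between [Top, Top, Top] w [Right, Right, Right] \<and>
      \<not> word_between [Left, Left, Left] w [Right, Right, Right]} =
      set (filter (\<lambda>w. \<not> word_between [Top, Top, Top] w [Left, Left, Left] \<and>
      \<not> word_between [Top, Top, Top] w [Right, Right, Right] \<and>
      \<not> word_between [Left, Left, Left] w [Right, Right, Right]) words2)"
    by simp
  also have "\<dots> = {[Top, Left, Right], [Left, Top, Right], [Right, Top, Left]}"
    by code_simp
  finally show ?thesis by (simp add: proper2_def)
qed

section \<open>Slices of a set and the guards they inherit\<close>

definition slice :: "nat \<Rightarrow> corner \<Rightarrow> vertex set \<Rightarrow> vertex set" where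
  "slice n c M = {x \<in> ST_verts n. inj_copy c x \<in> M}"

lemma slice_in_verts: "x \<in> slice n c M \<Longrightarrow> x \<in> ST_verts n"
  by (simp add: slice_def)

lemma finite_slice [simp]: "finite (slice n c M)"
  using ST.pair_finite_verts by (rule finite_subset[rotated]) (auto simp: slice_def)

lemma eq_UN_slice:
  assumes "M \<subseteq> ST_verts (Suc n)"
  shows "M = (\<Union>c. inj_copy c ` slice n c M)"
proof
  show "M \<subseteq> (\<Union>c. inj_copy c ` slice n c M)"
  proof
    fix v assume "v \<in> M"
    with assms obtain c x where "x \<in> ST_verts n" "v = inj_copy c x" by (blast elim: ST_verts_SucE)
    with \<open>v \<in> M\<close> show "v \<in> (\<Union>c. inj_copy c ` slice n c M)" by (auto simp: slice_def)
  qed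
qed (auto simp: slice_def)

lemma gpos_slice: "gpos (Suc n) M \<Longrightarrow> gpos n (slice n c M)"
  by (auto simp: gpos_iff slice_def between_inj_copy[symmetric, where c = c] inj_copy_eq_iff)

text \<open>Points of copy \<open>c\<close> are within \<open>2 ^ n\<close> of the outer corner
  \<open>c\<close> and at least \<open>2 ^ n\<close> away from any other corner \<open>e\<close>, so
  the exception granted by a weak guard cannot occur. The resulting full guard holds with every
  slack \<open>k\<close>.\<close>

lemma guard_slice_same:
  assumes "guard (Suc n) 0 c e M"
  shows "guard n k c c (slice n c M)"
  unfolding guard_def
proof (intro ballI impI, elim conjE)
  fix y z assume y: "y \<in> slice n c M" and z: "z \<in> slice n c M" and "y \<noteq> z" "between n (Corner c) y z"
  have "between (Suc n) (Corner c) (inj_copy c y) (inj_copy c z)"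
    using between_inj_copy[of "Corner c" n y z c] y z \<open>between n _ y z\<close> by (simp add: slice_def)
  then have less: "ST_dist (Suc n) (Corner e) (inj_copy c z) < ST_dist (Suc n) (Corner c) (inj_copy c z)"
    using assms y z \<open>y \<noteq> z\<close> by (auto simp: guard_def slice_def inj_copy_eq_iff)
  have zV: "z \<in> ST_verts n" using z by (rule slice_in_verts)
  have "ST_dist (Suc n) (Corner c) (inj_copy c z) \<le> 2 ^ n"
    using dist_Suc[of "Corner c" n z c c] zV dist_corner_le[OF zV, of c] ST.hops_commute[of n "Corner c" z]
    by (simp add: copy_dist_def)
  moreover have "2 ^ n \<le> ST_dist (Suc n) (Corner e) (inj_copy c z)" if "e \<noteq> c"
    using dist_Suc[of "Corner e" n z e c] zV that third_neq[of e c] dist_corners[of e _ n]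
    by (auto simp: copy_dist_def)
  ultimately have "e = c" using less by force
  then show "ST_dist n (Corner c) z + k < ST_dist n (Corner c) z"
    using less by simp
qed

text \<open>If \<open>z\<close> violates the guard inequality, then \<open>near\<close> makes the
  direct route from \<open>x\<close> to \<open>z\<close> no longer than the detour. A point
  \<open>y\<close> between \<open>Corner d\<close> and \<open>z\<close> then lies between
  \<open>x\<close> and \<open>z\<close>. The condition \<open>x \<noteq> Corner c\<close> keeps
  \<open>x\<close> out of copy \<open>c\<close>.\<close>

lemma guard_slice_other:
  assumes M: "gpos (Suc n) M" and "c \<noteq> d" and x: "x \<in> slice n d M" "x \<noteq> Corner c"
    and near: "ST_dist n x (Corner c) + k \<le> ST_dist n x (Corner (third c d)) + 2 ^ n"
  shows "guard n k d (third c d) (slice n c M)"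
  unfolding guard_def
proof (intro ballI impI, elim conjE, rule ccontr)
  fix y z assume y: "y \<in> slice n c M" and z: "z \<in> slice n c M" and "y \<noteq> z"
    and betw: "between n (Corner d) y z"
    and "\<not> ST_dist n (Corner (third c d)) z + k < ST_dist n (Corner d) z"
  note V = x(1)[THEN slice_in_verts] y[THEN slice_in_verts] z[THEN slice_in_verts]
  have xz: "ST_dist (Suc n) (inj_copy d x) (inj_copy c z) = ST_dist n x (Corner c) + ST_dist n (Corner d) z"
    using near \<open>c \<noteq> d\<close> \<open>\<not> _ < _\<close> third_commute[of c d]
    by (simp add: dist_Suc V copy_dist_def)
  have xy: "ST_dist (Suc n) (inj_copy d x) (inj_copy c y) \<le> ST_dist n x (Corner c) + ST_dist n (Corner d) y"
    using dist_copies_le V by blast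
  have yz: "ST_dist (Suc n) (inj_copy c y) (inj_copy c z) = ST_dist n y z"
    by (simp add: dist_Suc V copy_dist_def)
  have "ST_dist (Suc n) (inj_copy d x) (inj_copy c z) \<le>
      ST_dist (Suc n) (inj_copy d x) (inj_copy c y) + ST_dist (Suc n) (inj_copy c y) (inj_copy c z)"
    by (intro ST.hops_triangle inj_copy_in_verts V)
  then have "between (Suc n) (inj_copy d x) (inj_copy c y) (inj_copy c z)"
    using xz xy yz betw by (simp add: between_def)
  moreover have "inj_copy d x \<noteq> inj_copy c y" "inj_copy d x \<noteq> inj_copy c z" "inj_copy c y \<noteq> inj_copy c z"
    using \<open>c \<noteq> d\<close> x(2) \<open>y \<noteq> z\<close> by (auto simp: inj_copy_eq_iff)
  ultimately show False
    using M x y z by (auto simp: gpos_iff slice_def)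
qed

text \<open>All neighbours of \<open>Corner e\<close> lie in copy \<open>e\<close>, so there are
  never more than the two at depth 0.\<close>

lemma card_corner_neighbours: "card {x \<in> ST_verts n. ST_dist n x (Corner e) = 1} \<le> 2"
proof (induction n)
  case 0
  have "{x \<in> ST_verts 0. ST_dist 0 x (Corner e) = 1} \<subseteq> Corner ` (- {e})"
    by (auto simp: ST_verts_0)
  then have "card {x \<in> ST_verts 0. ST_dist 0 x (Corner e) = 1} \<le> card (Corner ` (- {e}))"
    by (intro card_mono) auto
  also have "\<dots> \<le> card (- {e})" by (rule card_image_le) simp
  also have "\<dots> = 2" by (simp add: Compl_eq_Diff_UNIV card_Diff_singleton) (cases e; simp add: UNIV_corner)
  finally show ?case .
next
  case (Suc n)
  let ?N = "\<lambda>n. {x \<in> ST_verts n. ST_dist n x (Corner e) = 1}"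
  have "?N (Suc n) \<subseteq> inj_copy e ` ?N n"
  proof
    fix v assume "v \<in> ?N (Suc n)"
    then obtain c x where x: "x \<in> ST_verts n" "v = inj_copy c x"
      and dist: "ST_dist (Suc n) (inj_copy c x) (inj_copy e (Corner e)) = 1"
      by (auto elim: ST_verts_SucE)
    show "v \<in> inj_copy e ` ?N n"
    proof (cases "c = e")
      case True
      then show ?thesis using x dist by (auto simp: dist_Suc copy_dist_def simp del: inj_copy.simps)
    next
      case False
      have pos: "(2::nat) ^ n \<ge> 1" by simp
      \<comment> \<open>A neighbour in another copy requires \<open>n = 0\<close> and
        \<open>x = Corner e\<close>; this is a gluing vertex, which also belongs to copy
        \<open>e\<close>.\<close>
      have "ST_dist n x (Corner e) + 2 ^ n = 1"
      proof -
        have "min (ST_dist n x (Corner e) + 2 ^ n) (ST_dist n x (Corner (third c e)) + 2 ^ n + 2 ^ n) = 1"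
          using dist False third_neq[OF False] x(1)
          by (simp add: dist_Suc copy_dist_def dist_corners del: inj_copy.simps)
        then show ?thesis using pos by linarith
      qed
      then have "ST_dist n x (Corner e) = 0" "(2::nat) ^ n = 1"
        using pos by linarith+
      then have "x = Corner e" "(2::nat) ^ n = 1"
        using x(1) ST.hops_eq_0_iff[of x n "Corner e"] by auto
      then have "v = inj_copy e (Corner c)" "ST_dist n (Corner c) (Corner e) = 1"
        using x False inj_copy_Corner_swap dist_corners by auto
      then show ?thesis by (auto simp del: inj_copy.simps)
    qed
  qed
  then have "card (?N (Suc n)) \<le> card (inj_copy e ` ?N n)"
    using ST.pair_finite_verts by (intro card_mono) auto
  also have "\<dots> \<le> card (?N n)"
    using ST.pair_finite_verts by (intro card_image_le) auto
  finally show ?case using Suc.IH by simp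
qed

section \<open>Counting a set through its slices\<close>

lemma card_corner_set: "card A = of_bool (c \<in> A) + of_bool (d \<in> A) + of_bool (third c d \<in> A)"
  if "c \<noteq> d" for A :: "corner set"
proof -
  have UNIV: "UNIV = {c, d, third c d}"
    using third_cases[OF that] by blast
  have "card A = (\<Sum>a\<in>UNIV. of_bool (a \<in> A))"
    by (simp add: sum_of_bool_eq)
  also have "\<dots> = of_bool (c \<in> A) + of_bool (d \<in> A) + of_bool (third c d \<in> A)"
    unfolding UNIV using that third_neq[OF that] by auto
  finally show ?thesis .
qed

lemma card_le_slices:
  assumes "M \<subseteq> ST_verts (Suc n)"
  shows "card M \<le> (\<Sum>c\<in>UNIV. card (slice n c M))"
proof -
  have "card M \<le> (\<Sum>c\<in>UNIV. card (inj_copy c ` slice n c M))"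
    by (subst eq_UN_slice[OF assms]) (rule card_UN_le, simp)
  also have "\<dots> = (\<Sum>c\<in>UNIV. card (slice n c M))"
    by (simp add: card_image inj_on_subset[OF inj_inj_copy])
  finally show ?thesis .
qed

lemma sum_corner: "c \<noteq> d \<Longrightarrow> (\<Sum>a\<in>UNIV. f a) = f c + f d + (f (third c d) :: nat)"
proof -
  assume "c \<noteq> d"
  then have UNIV: "UNIV = {c, d, third c d}" using third_cases by blast
  show ?thesis
    unfolding UNIV using \<open>c \<noteq> d\<close> third_neq[OF \<open>c \<noteq> d\<close>] by auto
qed

lemma card_le_two_slices:
  assumes M: "M \<subseteq> ST_verts (Suc n)" and "c \<noteq> d" and sub: "slice n d M \<subseteq> {Corner c}"
  shows "card M \<le> card (slice n c M) + card (slice n (third c d) M)"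
proof -
  let ?e = "third c d"
  have "M \<subseteq> inj_copy c ` slice n c M \<union> inj_copy ?e ` slice n ?e M"
  proof
    fix v assume "v \<in> M"
    then obtain a x where x: "x \<in> slice n a M" "v = inj_copy a x"
      using eq_UN_slice[OF M] by blast
    show "v \<in> inj_copy c ` slice n c M \<union> inj_copy ?e ` slice n ?e M"
    proof (cases "a = d")
      case True
      then have "v = inj_copy c (Corner d)"
        using x sub inj_copy_Corner_swap by blast
      then have "Corner d \<in> slice n c M"
        using \<open>v \<in> M\<close> by (simp add: slice_def)
      then show ?thesis using \<open>v = inj_copy c (Corner d)\<close> by blast
    next
      case False
      then show ?thesis using third_cases[OF \<open>c \<noteq> d\<close>, of a] x by blast
    qed
  qed
  then have "card M \<le> card (inj_copy c ` slice n c M \<union> inj_copy ?e ` slice n ?e M)"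
    by (intro card_mono) auto
  also have "\<dots> \<le> card (inj_copy c ` slice n c M) + card (inj_copy ?e ` slice n ?e M)"
    by (rule card_Un_le)
  also have "\<dots> = card (slice n c M) + card (slice n ?e M)"
    by (simp add: card_image inj_on_subset[OF inj_inj_copy])
  finally show ?thesis .
qed

text \<open>A gluing vertex in \<open>M\<close> is counted in two slices. This keeps extremal sets
  off the gluing vertices.\<close>

lemma card_less_slices:
  assumes M: "M \<subseteq> ST_verts (Suc n)" and "c \<noteq> d" and common: "Corner c \<in> slice n d M"
  shows "card M < (\<Sum>a\<in>UNIV. card (slice n a M))"
proof -
  let ?N = "M - inj_copy d ` (slice n d M - {Corner c})"
  have common': "Corner d \<in> slice n c M"
    using common inj_copy_Corner_swap[of c d] by (simp add: slice_def del: inj_copy.simps)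
  have "?N \<subseteq> ST_verts (Suc n)" using M by blast
  have "slice n d ?N \<subseteq> {Corner c}"
    by (auto simp: slice_def)
  then have "card ?N \<le> card (slice n c ?N) + card (slice n (third c d) ?N)"
    using card_le_two_slices \<open>?N \<subseteq> _\<close> \<open>c \<noteq> d\<close> by blast
  also have "\<dots> \<le> card (slice n c M) + card (slice n (third c d) M)"
    by (intro add_mono card_mono finite_slice) (auto simp: slice_def)
  finally have "card ?N \<le> card (slice n c M) + card (slice n (third c d) M)" .
  moreover have "M = ?N \<union> inj_copy d ` (slice n d M - {Corner c})"
    by (auto simp: slice_def)
  then have "card M \<le> card ?N + card (inj_copy d ` (slice n d M - {Corner c}))"
    by (metis card_Un_le)
  moreover have "card (inj_copy d ` (slice n d M - {Corner c})) < card (slice n d M)"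
    using card_Diff1_less[OF finite_slice common] card_image_le[of "slice n d M - {Corner c}" "inj_copy d"]
    by (simp add: order_le_less_trans)
  ultimately show ?thesis
    using sum_corner[OF \<open>c \<noteq> d\<close>, of "\<lambda>a. card (slice n a M)"] by linarith
qed

text \<open>The distance to \<open>Corner c\<close> is at most \<open>2 ^ n\<close>, so distance at
  least 2 from \<open>Corner e\<close> gives the slack. Only \<open>Corner e\<close> and its at most
  two neighbours are closer, and \<open>S\<close> has three points other than
  \<open>Corner e\<close>.\<close>

lemma exists_guarding_point:
  assumes "3 \<le> card S" "S \<subseteq> ST_verts n" "Corner e \<notin> S"
  obtains x where "x \<in> S" "ST_dist n x (Corner c) + 2 \<le> ST_dist n x (Corner e) + 2 ^ n"
proof (cases "\<exists>x\<in>S. ST_dist n x (Corner e) \<noteq> 1")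
  case True
  then obtain x where x: "x \<in> S" "ST_dist n x (Corner e) \<noteq> 1" by blast
  then have "ST_dist n x (Corner e) \<noteq> 0"
    using assms ST.hops_eq_0_iff[of x n "Corner e"] by auto
  then have "2 \<le> ST_dist n x (Corner e)" using x(2) by simp
  then show thesis
    using that[OF x(1)] dist_corner_le[of x n c] assms(2) x(1) by auto
next
  case False
  then have "card S \<le> card {x \<in> ST_verts n. ST_dist n x (Corner e) = 1}"
    using assms(2) ST.pair_finite_verts by (intro card_mono) auto
  then show thesis
    using assms(1) card_corner_neighbours[of n e] by simp
qed

lemma gpos_upper_bound:
  assumes "2 \<le> n" "gpos n M" "\<And>a. a \<in> A \<Longrightarrow> guard n 0 a (third b a) M"
  shows "card M + card A \<le> 3 ^ (n - 1) + 3 \<and>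
    (card M + card A = 3 ^ (n - 1) + 3 \<longrightarrow> (\<forall>a\<in>A. guard n 2 a (third b a) M) \<longrightarrow>
      M = central n \<union> Corner ` (- A))"
  using assms
proof (induction n arbitrary: M A b rule: nat_induct_at_least)
  case base
  then show ?case
    using gpos_2[of M A b] by (auto simp: central_2)
next
  case (Suc n)
  define K where "K = (3::nat) ^ (n - 1)"
  have K: "3 \<le> K" "3 ^ (Suc n - 1) = 3 * K"
  proof -
    show "3 \<le> K" unfolding K_def using \<open>2 \<le> n\<close> by (intro self_le_power) auto
    show "3 ^ (Suc n - 1) = 3 * K"
      unfolding K_def using \<open>2 \<le> n\<close> by (cases n) auto
  qed
  have M: "M \<subseteq> ST_verts (Suc n)" using Suc.prems(1) by (simp add: gpos_iff)
  have IH: "card (slice n c M) + card B \<le> K + 3"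
    if "\<And>a. a \<in> B \<Longrightarrow> guard n 0 a (third c a) (slice n c M)" for B c
    using Suc.IH[OF gpos_slice[OF Suc.prems(1)] that] by (auto simp: K_def)
  have same: "guard n k c (third c c) (slice n c M)" if "c \<in> A" for c k
    using guard_slice_same Suc.prems(2)[OF that] by simp
  have other: "guard n 0 d (third c d) (slice n c M)"
    if "c \<noteq> d" "x \<in> slice n d M" "x \<noteq> Corner c" for c d x
    using that slice_in_verts[OF that(2)] dist_corner_le[of x n c]
    by (intro guard_slice_other[OF Suc.prems(1)]) auto
  show ?case
  proof (cases "\<forall>c d. c \<noteq> d \<longrightarrow> (\<exists>x\<in>slice n d M. x \<noteq> Corner c)")
    case False
    \<comment> \<open>Copy \<open>d\<close> contributes at most a gluing vertex, which copy
      \<open>c\<close> counts anyway. Two slices are too few for equality, so a strict bound settles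
      both claims.\<close>
    then obtain c d where "c \<noteq> d" and sub: "slice n d M \<subseteq> {Corner c}" by blast
    define e where "e = third c d"
    have e: "e \<noteq> c" "e \<noteq> d" using third_neq[OF \<open>c \<noteq> d\<close>] by (auto simp: e_def)
    have card_A: "card A = of_bool (c \<in> A) + of_bool (d \<in> A) + of_bool (e \<in> A)"
      using card_corner_set[OF \<open>c \<noteq> d\<close>] by (simp add: e_def)
    have card_M: "card M \<le> card (slice n c M) + card (slice n e M)"
      using card_le_two_slices[OF M \<open>c \<noteq> d\<close> sub] by (simp add: e_def)
    have "card M + card A < 3 * K + 3"
    \<comment> \<open>If copies \<open>c\<close> and \<open>e\<close> guard each other, the total is
      at most \<open>2 * K + 5\<close>; otherwise one of them has at most one point and the total is
      at most \<open>K + 7\<close>. Both are below \<open>3 * K + 3\<close> as \<open>K\<close> is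
      at least 3.\<close>
    proof (cases "(\<exists>x\<in>slice n e M. x \<noteq> Corner c) \<and> (\<exists>x\<in>slice n c M. x \<noteq> Corner e)")
      case True
      have "card (slice n c M) + card ({e} \<union> {c} \<inter> A) \<le> K + 3"
        by (rule IH) (use True e same other in auto)
      moreover have "card (slice n e M) + card ({c} \<union> {e} \<inter> A) \<le> K + 3"
        by (rule IH) (use True e same other in auto)
      moreover have "card ({e} \<union> {c} \<inter> A) = 1 + of_bool (c \<in> A)"
        "card ({c} \<union> {e} \<inter> A) = 1 + of_bool (e \<in> A)"
        using e by auto
      moreover have "of_bool (d \<in> A) \<le> (1::nat)" by simp
      ultimately show ?thesis using card_M card_A K(1) by linarith
    next
      case False
      then have "slice n e M \<subseteq> {Corner c} \<or> slice n c M \<subseteq> {Corner e}" by blast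
      then have "card (slice n e M) \<le> 1 \<or> card (slice n c M) \<le> 1"
        using card_mono[of "{Corner _}"] by fastforce
      moreover have "card (slice n e M) \<le> K + 3" "card (slice n c M) \<le> K + 3"
        using IH[of "{}"] by auto
      moreover have "card A \<le> 3" unfolding card_A by simp
      ultimately show ?thesis using card_M K(1) by linarith
    qed
    then show ?thesis using K(2) by simp
  next
    case True
    note strict = True
    \<comment> \<open>The guarded corners of copy \<open>c\<close>: both inner ones, guarded by
      points in the other copies, and the outer one if it is in \<open>A\<close>. Over all copies
      these are \<open>6 + card A\<close> corners.\<close>
    define B where "B c = - {c} \<union> ({c} \<inter> A)" for c
    have guard0: "guard n 0 a (third c a) (slice n c M)" if "a \<in> B c" for a c
    proof (cases "a = c")
      case True
      then show ?thesis using same that by (auto simp: B_def)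
    next
      case False
      then obtain x where "x \<in> slice n a M" "x \<noteq> Corner c"
        using strict by metis
      with False show ?thesis by (intro other) auto
    qed
    have slice_bound: "card (slice n c M) + card (B c) \<le> K + 3" for c
      by (rule IH) (rule guard0)
    have card_B: "card (B c) = 2 + of_bool (c \<in> A)" for c
    proof -
      obtain d where "c \<noteq> d" using corner.distinct(1) by metis
      then show ?thesis
        using card_corner_set[of c d "B c"] third_neq[of c d] by (auto simp: B_def)
    qed
    have card_M: "card M \<le> (\<Sum>c\<in>UNIV. card (slice n c M))"
      using card_le_slices[OF M] .
    have sums: "(\<Sum>c\<in>UNIV. card (slice n c M)) =
        card (slice n Top M) + card (slice n Left M) + card (slice n Right M)"
      "card A = of_bool (Top \<in> A) + of_bool (Left \<in> A) + of_bool (Right \<in> A)"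
      using sum_corner[of Top Left] card_corner_set[of Top Left A] by auto
    note bounds = slice_bound[of Top] slice_bound[of Left] slice_bound[of Right]
    have bound: "card M + card A \<le> 3 * K + 3"
      using card_M bounds unfolding card_B sums by linarith
    moreover have "M = central (Suc n) \<union> Corner ` (- A)" if eq: "card M + card A = 3 * K + 3"
    proof -
      \<comment> \<open>The three slice bounds add up to exactly the total bound, so equality leaves
        no room in any slice and none for double counting.\<close>
      have tight: "card (slice n c M) + card (B c) = K + 3" for c
        using card_M bounds eq unfolding card_B sums by (cases c; hypsubst; linarith)
      have no_common: "Corner c \<notin> slice n d M" if "c \<noteq> d" for c d
        using card_less_slices[OF M that] bounds eq unfolding card_B sums by linarith
      \<comment> \<open>Uniqueness in the slices requires guards with slack 2. A tight slice has at
        least \<open>K\<close> points and contains no gluing vertex, so it supplies a guarding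
        point.\<close>
      have "guard n 2 d (third c d) (slice n c M)" if "c \<noteq> d" for c d
      proof -
        have "card (B d) \<le> 3" unfolding card_B by simp
        then have "3 \<le> card (slice n d M)" using tight[of d] K(1) by linarith
        moreover have "Corner (third c d) \<notin> slice n d M"
          using no_common third_neq[OF that] by blast
        ultimately obtain x where "x \<in> slice n d M"
          "ST_dist n x (Corner c) + 2 \<le> ST_dist n x (Corner (third c d)) + 2 ^ n"
          using exists_guarding_point[of "slice n d M" n] slice_in_verts by blast
        then show ?thesis
          using guard_slice_other[OF Suc.prems(1) that] no_common[OF that] by metis
      qed
      then have guards: "guard n 2 a (third c a) (slice n c M)" if "a \<in> B c" for a c
        using that same by (cases "a = c") (auto simp: B_def)
      have "slice n c M = central n \<union> Corner ` (- B c)" for c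
      proof -
        have "card (slice n c M) + card (B c) = 3 ^ (n - 1) + 3 \<longrightarrow>
            (\<forall>a\<in>B c. guard n 2 a (third c a) (slice n c M)) \<longrightarrow>
            slice n c M = central n \<union> Corner ` (- B c)"
          by (rule conjunct2[OF Suc.IH[OF gpos_slice[OF Suc.prems(1)]]]) (rule guard0)
        then show ?thesis using tight[of c] guards[of _ c] by (simp add: K_def)
      qed
      \<comment> \<open>The inner corners are all in \<open>B c\<close>, so only the outer corner
        can remain, and it does so exactly if it is not in \<open>A\<close>.\<close>
      then have "inj_copy c ` slice n c M = inj_copy c ` central n \<union> Corner ` ({c} - A)" for c
        by (auto simp: B_def image_Un)
      then have "M = (\<Union>c. inj_copy c ` central n \<union> Corner ` ({c} - A))"
        using eq_UN_slice[OF M] by simp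
      then show ?thesis
        using central_Suc[OF \<open>2 \<le> n\<close>] by auto
    qed
    ultimately show ?thesis using K(2) by simp
  qed
qed

section \<open>The extremal set\<close>

lemma central_2_eq:
  "central 2 = {In Top (Mid {Left, Right}), In Left (Mid {Top, Right}), In Right (Mid {Top, Left})}"
  by (simp add: central_2 proper2_def)

lemma central_verts: "2 \<le> n \<Longrightarrow> central n \<subseteq> ST_verts n"
  using copies_verts by (fastforce simp: central_def proper_vertices_def)

lemma inj_copy_eq_Corner_iff: "inj_copy a x = Corner c \<longleftrightarrow> a = c \<and> x = Corner c"
  using inj_copy_eq_iff[of a x c "Corner c"] by auto

lemma Corner_notin_central: "2 \<le> n \<Longrightarrow> Corner c \<notin> central n"
proof (induction n arbitrary: c rule: nat_induct_at_least)
  case base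
  then show ?case by (simp add: central_2_eq)
next
  case (Suc n)
  then show ?case by (auto simp: central_Suc inj_copy_eq_Corner_iff dest: sym)
qed

lemma finite_central: "2 \<le> n \<Longrightarrow> finite (central n)"
  using central_verts ST.pair_finite_verts finite_subset by blast

lemma card_central: "2 \<le> n \<Longrightarrow> card (central n) = 3 ^ (n - 1)"
proof (induction n rule: nat_induct_at_least)
  case base
  then show ?case by (simp add: central_2_eq)
next
  case (Suc n)
  have "card (central (Suc n)) = (\<Sum>c\<in>UNIV. card (inj_copy c ` central n))"
    unfolding central_Suc[OF Suc.hyps]
    using Corner_notin_central[OF Suc.hyps] finite_central[OF Suc.hyps]
    by (intro card_UN_disjoint) (auto simp: inj_copy_eq_iff)
  also have "\<dots> = (\<Sum>c\<in>(UNIV :: corner set). 3 ^ (n - 1))"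
    using Suc.IH by (simp add: card_image inj_on_subset[OF inj_inj_copy])
  also have "\<dots> = 3 ^ (Suc n - 1)"
    using Suc.hyps by (cases n) (auto simp: UNIV_corner)
  finally show ?case .
qed

lemma card_range_Corner: "card (range Corner) = 3"
  by (simp add: card_image inj_def UNIV_corner)

lemma card_central_corners: "2 \<le> n \<Longrightarrow> card (central n \<union> range Corner) = 3 ^ (n - 1) + 3"
  using Corner_notin_central finite_central
  by (subst card_Un_disjoint) (auto simp: card_central card_range_Corner)

lemma gpos_corners: "gpos n (range Corner)"
  by (auto simp: gpos_iff between_def dist_corners)

text \<open>A point of the glued set in copy \<open>a\<close> is never a gluing vertex, so a shortest path which
  leaves the copy through a corner \<open>d\<close> would make two points collinear with \<open>Corner d\<close> inside the copy.\<close>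

lemma gpos_glue:
  assumes Z: "gpos n Z" and corners: "range Corner \<subseteq> Z"
  shows "gpos (Suc n) (\<Union>a. inj_copy a ` (Z - Corner ` (- {a})))"
proof -
  define P where "P a = Z - Corner ` (- {a})" for a
  have P: "x \<in> Z" "x \<in> ST_verts n" "d \<noteq> a \<Longrightarrow> x \<noteq> Corner d" if "x \<in> P a" for x a d
    using that Z by (auto simp: P_def gpos_iff)
  define D where "D x y = ST_dist n x y" for x y
  have dist: "ST_dist (Suc n) (inj_copy a x) (inj_copy b y) = (if a = b then D x y else
      min (D x (Corner b) + D y (Corner a)) (D x (Corner (third a b)) + 2 ^ n + D y (Corner (third a b))))"
    if "x \<in> P a" "y \<in> P b" for a b x y
    using that P(2) ST.hops_commute[of n "Corner _" y] by (simp add: dist_Suc copy_dist_def D_def)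
  have le: "D x (Corner d) \<le> 2 ^ n" if "x \<in> P a" for x a d
    using dist_corner_le P(2)[OF that] by (simp add: D_def)
  have pos: "0 < D x (Corner d)" if "x \<in> P a" "d \<noteq> a" for x a d
    using ST.hops_eq_0_iff[OF P(2)[OF that(1)] Corner_in_verts] P(3)[OF that]
    by (simp add: D_def zero_less_iff_neq_zero)
  have tri: "D x z \<le> D x y + D y z" if "x \<in> ST_verts n" "y \<in> ST_verts n" "z \<in> ST_verts n" for x y z
    using ST.hops_triangle that by (simp add: D_def)
  have strict: "D x z < D x y + D y z"
    if "x \<in> Z" "y \<in> Z" "z \<in> Z" "x \<noteq> y" "x \<noteq> z" "y \<noteq> z" for x y z
  proof -
    have "\<not> between n x y z" "x \<in> ST_verts n" "y \<in> ST_verts n" "z \<in> ST_verts n"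
      using that Z by (auto simp: gpos_iff)
    then show ?thesis
      using tri[of x y z] by (simp add: D_def between_def)
  qed
  \<comment> \<open>\<open>Corner d\<close> is itself a point of \<open>Z\<close>, so general
    position at depth \<open>n\<close> makes the triangle inequality strict.\<close>
  have exit: "D x (Corner d) < D x y + D y (Corner d)"
    if "x \<in> P a" "y \<in> P a" "x \<noteq> y" "d \<noteq> a" for x y a d
    using strict[of x y "Corner d"] that P corners by blast
  have side: "\<not> between (Suc n) (inj_copy a x) (inj_copy a y) (inj_copy c z)"
    if "x \<in> P a" "y \<in> P a" "z \<in> P c" "x \<noteq> y" "a \<noteq> c" for a c x y z
    using exit[OF that(1,2,4), of c] exit[OF that(1,2,4), of "third a c"] that third_neq[OF that(5)]
    by (auto simp: between_def dist min_def)
  have main: "\<not> between (Suc n) (inj_copy a x) (inj_copy b y) (inj_copy c z)"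
    if x: "x \<in> P a" and y: "y \<in> P b" and z: "z \<in> P c"
      and neq: "inj_copy a x \<noteq> inj_copy b y" "inj_copy a x \<noteq> inj_copy c z" "inj_copy b y \<noteq> inj_copy c z"
    for a b c x y z
  proof -
    consider "a = b" "b = c" | "a = b" "b \<noteq> c" | "b = c" "a \<noteq> b" | "a = c" "a \<noteq> b"
      | "a \<noteq> b" "b \<noteq> c" "a \<noteq> c" by blast
    then show ?thesis
    proof cases
      case 1
      then show ?thesis
        using strict[of x y z] x y z neq P(1) by (auto simp: between_def dist inj_copy_eq_iff)
    next
      case 2
      then show ?thesis using side[of x a y z c] x y z neq by auto
    next
      case 3
      then show ?thesis
        using side[of z c y x a] x y z neq between_commute by auto
    next
      case 4
      \<comment> \<open>A trip from \<open>x\<close> to \<open>y\<close> and back to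
        \<open>z\<close> is too long. If it uses the same corner both ways, the triangle inequality
        at that corner shows this; otherwise it also crosses a copy at cost \<open>2 ^ n\<close>,
        which already covers the distance from \<open>z\<close> to \<open>Corner b\<close>.\<close>
      define e where "e = third a b"
      have e: "third a b = e" "third b a = e"
        by (auto simp: e_def third_commute)
      have V: "x \<in> ST_verts n" "z \<in> ST_verts n" using P(2) x z by auto
      have "D x z \<le> D x (Corner d) + D z (Corner d)" for d
        using tri[OF V(1) Corner_in_verts V(2), of d] ST.hops_commute[of n "Corner d" z] by (simp add: D_def)
      from this[of b] this[of e] show ?thesis
        using x y z 4 pos[OF y, of a] le[OF x, of b] le[OF x, of e] le[OF z, of b] le[OF z, of e]
        by (auto simp: between_def dist min_def e[unfolded 4(1)])
    next
      case 5
      have third: "third a b = c" "third b c = a" "third a c = b"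
        using 5 by (cases a; cases b; cases c; simp)+
      \<comment> \<open>\<open>y\<close> is off the shortest paths between the two inner corners of
        its copy, so going from \<open>x\<close> to \<open>z\<close> through \<open>y\<close> costs
        more than crossing copy \<open>b\<close> along its side.\<close>
      have "2 ^ n < D y (Corner a) + D y (Corner c)"
        using strict[of "Corner a" y "Corner c"] corners P[OF y] 5 dist_corners[of a c n]
          ST.hops_commute[of n "Corner a" y] by (auto simp: D_def)
      then show ?thesis
        using x y z 5 pos[OF y, of a] pos[OF y, of c] le[OF x, of b] le[OF x, of c] le[OF z, of a] le[OF z, of b]
        by (auto simp: between_def dist third min_def)
    qed
  qed
  have "gpos (Suc n) (\<Union>a. inj_copy a ` P a)"
    unfolding gpos_iff
  proof (intro conjI ballI impI)
    show "(\<Union>a. inj_copy a ` P a) \<subseteq> ST_verts (Suc n)"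
      using P(2) inj_copy_in_verts by blast
  next
    fix u v w
    assume "u \<in> (\<Union>a. inj_copy a ` P a)" "v \<in> (\<Union>a. inj_copy a ` P a)" "w \<in> (\<Union>a. inj_copy a ` P a)"
      and neq: "u \<noteq> v" "u \<noteq> w" "v \<noteq> w"
    then obtain a b c x y z where "u = inj_copy a x" "x \<in> P a" "w = inj_copy b y" "y \<in> P b"
      "v = inj_copy c z" "z \<in> P c"
      by (elim UN_E imageE)
    then show "\<not> between (Suc n) u w v"
      using main[of x a y b z c] neq by simp
  qed
  then show ?thesis by (simp add: P_def)
qed

lemma gpos_central_2: "gpos 2 (central 2 \<union> range Corner)"
proof -
  define W where "W = [[Top, Left, Right], [Left, Top, Right], [Right, Top, Left],
    [Top, Top, Top], [Left, Left, Left], [Right, Right, Right]]"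
  have len: "length w = Suc 2" if "w \<in> set W" for w
    using that by (auto simp: W_def)
  have ok: "\<forall>u\<in>set W. \<forall>v\<in>set W. \<forall>w\<in>set W. u \<noteq> v \<longrightarrow> u \<noteq> w \<longrightarrow> v \<noteq> w \<longrightarrow> \<not> word_between u w v"
    unfolding W_def by code_simp
  have "central 2 \<union> range Corner = vert ` set W"
    by (auto simp: central_2 proper2_def W_def UNIV_corner)
  moreover have "gpos 2 (vert ` set W)"
    using len by (auto simp: gpos_iff between_vert vert_in_verts) (metis ok)
  ultimately show ?thesis by simp
qed

text \<open>Removing the inner corners from each copy before gluing leaves its central part and its
  outer corner, which together form the set of the next depth.\<close>

lemma gpos_central: "2 \<le> n \<Longrightarrow> gpos n (central n \<union> range Corner)"
proof (induction n rule: nat_induct_at_least)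
  case base
  show ?case by (rule gpos_central_2)
next
  case (Suc n)
  have "inj_copy a ` (central n \<union> range Corner - Corner ` (- {a})) = inj_copy a ` central n \<union> {Corner a}" for a
  proof -
    have "central n \<union> range Corner - Corner ` (- {a}) = insert (Corner a) (central n)"
      using Corner_notin_central[OF Suc.hyps] by auto
    then show ?thesis by simp
  qed
  then have "(\<Union>a. inj_copy a ` (central n \<union> range Corner - Corner ` (- {a}))) = central (Suc n) \<union> range Corner"
    by (auto simp: central_Suc[OF Suc.hyps])
  then show ?case
    using gpos_glue[OF Suc.IH] by simp
qed

lemma gp_eqI:
  assumes "gpos n M" "card M = k" "\<And>M. gpos n M \<Longrightarrow> card M \<le> k"
  shows "gp (graph_of (ST n)) = k"
  unfolding gp_def
proof (rule Max_eqI)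
  show "finite {card M |M. gpos n M}"
    by (rule finite_subset[of _ "{..k}"]) (use assms(3) in auto)
qed (use assms in auto)

theorem theorem2:
  fixes n :: nat
  assumes "n \<ge> 1"
  shows "gp (graph_of (ST n)) = (if n = 1 then 3 else 3 ^ (n - 1) + 3) \<and>
    (n \<ge> 2 \<longrightarrow>
      (\<forall>M \<subseteq> pverts (graph_of (ST n)).
        general_position (graph_of (ST n)) M \<and> card M = gp (graph_of (ST n)) \<longleftrightarrow>
        M = (\<Union>H \<in> copies 2 n. proper_vertices (graph_of (ST n)) H) \<union> range (extreme (ST n))))"
proof (cases "n = 1")
  case True
  have "gp (graph_of (ST 1)) = 3"
    by (rule gp_eqI[OF gpos_corners card_range_Corner card_gpos_1])
  with True show ?thesis by simp
next
  case False
  with assms have n: "2 \<le> n" by simp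
  have bound: "card M \<le> 3 ^ (n - 1) + 3" if "gpos n M" for M
    using gpos_upper_bound[OF n that, of "{}"] by simp
  have gp: "gp (graph_of (ST n)) = 3 ^ (n - 1) + 3"
    by (rule gp_eqI[OF gpos_central[OF n] card_central_corners[OF n] bound])
  \<comment> \<open>With no guarded corners the guard hypotheses are vacuous and the extremal set
    contains all three corners.\<close>
  have "gpos n M \<and> card M = 3 ^ (n - 1) + 3 \<longleftrightarrow> M = central n \<union> range Corner" for M
    using gpos_upper_bound[OF n, of M "{}"] gpos_central[OF n] card_central_corners[OF n] by auto
  then show ?thesis
    using False gp by (simp add: central_def extreme_ST)
qed

end
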